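(* For every natural number $n\ge 1$ there exists a Tychonoff space $X$ that is zero-dimensional, is an $F$-space, and has covering dimension $\dim X=n$.
   Context: A topological space is zero-dimensional if it is a $T_1$-space and its clopen subsets form a base for its topology. A Tychonoff space $X$ is an $F$-space if for every continuous $f:X\to\mathbb{R}$ there is a continuous $k:X\to\mathbb{R}$ such that $f=k\cdot|f|$. The covering dimension of a Tychonoff space $X$ is defined via cozero sets: $\dim X\le n$ if every finite cover of $X$ by cozero sets has a finite refinement by cozero sets that covers $X$ and is such that every point of $X$ lies in at most $n+1$ of its members; $\dim X$ is the least such $n$ (and $\infty$ if there is none). With this definition $\dim X=\dim\beta X$, where $\beta X$ is the Čech–Stone compactification. The existence is asserted in $\mathsf{ZFC}$, with no additional set-theoretic assumptions. *)

theory Defs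
  imports "HOL-Analysis.Analysis"
begin

definition tychonoff_space :: "'a topology \<Rightarrow> bool" where
  "tychonoff_space X \<longleftrightarrow> t1_space X \<and> completely_regular_space X"

definition zero_dimensional_space :: "'a topology \<Rightarrow> bool" where
  "zero_dimensional_space X \<longleftrightarrow>
     t1_space X \<and> openin X = arbitrary union_of (\<lambda>U. openin X U \<and> closedin X U)"

definition F_space :: "'a topology \<Rightarrow> bool" where
  "F_space X \<longleftrightarrow>
     tychonoff_space X \<and>
     (\<forall>f. continuous_map X euclideanreal f \<longrightarrow>
        (\<exists>k. continuous_map X euclideanreal k \<and> (\<forall>x\<in>topspace X. f x = k x * \<bar>f x\<bar>)))"

definition cozero_set_in :: "'a topology \<Rightarrow> 'a set \<Rightarrow> bool" where
  "cozero_set_in X U \<longleftrightarrow>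
     (\<exists>f. continuous_map X euclideanreal f \<and> U = {x \<in> topspace X. f x \<noteq> 0})"

definition finite_cozero_cover :: "'a topology \<Rightarrow> 'a set set \<Rightarrow> bool" where
  "finite_cozero_cover X \<U> \<longleftrightarrow>
     finite \<U> \<and> (\<forall>U\<in>\<U>. cozero_set_in X U) \<and> \<Union>\<U> = topspace X"

definition covering_dim_le :: "'a topology \<Rightarrow> nat \<Rightarrow> bool" where
  "covering_dim_le X n \<longleftrightarrow>
     (\<forall>\<U>. finite_cozero_cover X \<U> \<longrightarrow>
        (\<exists>\<V>. finite_cozero_cover X \<V> \<and>
             (\<forall>V\<in>\<V>. \<exists>U\<in>\<U>. V \<subseteq> U) \<and>
             (\<forall>x\<in>topspace X. card {V \<in> \<V>. x \<in> V} \<le> n + 1)))"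

(* The infimum of the empty set in enat is \<infinity>. The empty space gets dimension 0 (not -1). *)
definition covering_dim :: "'a topology \<Rightarrow> enat" where
  "covering_dim X = Inf {enat n | n. covering_dim_le X n}"

lemma covering_dim_le_mono: "covering_dim_le X m \<Longrightarrow> m \<le> n \<Longrightarrow> covering_dim_le X n"
  unfolding covering_dim_le_def by (meson add_le_mono1 le_trans)

lemma covering_dim_le_iff: "covering_dim X \<le> enat n \<longleftrightarrow> covering_dim_le X n"
proof
  assume le: "covering_dim X \<le> enat n"
  let ?S = "{enat n | n. covering_dim_le X n}"
  have "?S \<noteq> {}"
  proof
    assume "?S = {}"
    then have "covering_dim X = \<infinity>"
      by (simp only: covering_dim_def Inf_enat_def) simp
    with le show False by simp
  qed
  then have "Inf ?S \<in> ?S"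
    by (metis (no_types, lifting) wellorder_InfI ex_in_conv)
  with le show "covering_dim_le X n"
    by (auto simp: covering_dim_def intro: covering_dim_le_mono)
next
  assume "covering_dim_le X n"
  then show "covering_dim X \<le> enat n"
    unfolding covering_dim_def by (auto intro: Inf_lower)
qed

lemma zero_dimensional_space_iff: "zero_dimensional_space X \<longleftrightarrow> t1_space X \<and> X dim_le 0"
  unfolding zero_dimensional_space_def dimension_le_0_neighbourhood_base_of_clopen
  by (subst open_neighbourhood_base_of; force simp: eq_commute[of "openin X"] openin_topology_base_unique
      intro: ext)

(* HOL has no quantification over types, so a space asserted to exist needs a fixed type of
   points. Only the cardinality of this type matters, because the carrier of a topology may be
   any subset of it: the choice bounds the number of points by the third iterated exponential
   of the continuum, i.e. 2^(2^(2^c)). *)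
type_synonym point = "real set set set"

end

theory Submission
  imports Defs
begin

text \<open>
  Let \<open>T\<close> be the set of points of a Tychonoff plank without its corner: a right side indexed by
  \<open>real\<close>, a top edge indexed by \<open>real set\<close>, and isolated interior points, where neighbourhoods on
  the right side omit at most continuum many points of the row and neighbourhoods on the top edge
  omit countably many points of the column. \<open>T\<close> is a P-space, and a locally constant map on \<open>T\<close>
  takes a common value on both edges.

  Over \<open>T\<close> we put copies of the compact space \<open>K\<close> of ultrafilters on the disjoint union of the
  grids \<open>{0..N}\<^sup>d\<close> along which \<open>N\<close> tends to infinity. Over the two edges, \<open>K\<close> is replaced by its
  quotients under the partitions of the grids into the blocks \<open>\<Prod>\<^sub>i {2k\<^sub>i, 2k\<^sub>i + 1}\<close> and
  \<open>\<Prod>\<^sub>i {2k\<^sub>i - 1, 2k\<^sub>i}\<close>. All fibres are zero-dimensional F-spaces. A continuous function on the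
  total space is a locally constant family of functions on \<open>K\<close>, hence somewhere invariant under
  both partitions, and such functions are those induced by functions on the grids whose
  oscillation between neighbours tends to \<open>0\<close>. These see the large-scale dimension \<open>d\<close> of the
  grids: Sperner's lemma gives the lower bound, Kolmogorov's \<open>d + 1\<close> staggered families of cubes
  the upper bound.
\<close>

subsection \<open>Ultrafilters\<close>

text \<open>A compact zero-dimensional space has dimension 0, because clopen partitions refine its
  finite cozero covers. Every point must therefore see a zero-dimensional space while the continuous
  real functions are globally forced to respect a larger identification. Passing to the quotient of
  \<open>K\<close> under both partitions at once would enforce that identification, but at the price
  of zero-dimensionality. Over the plank no point sees both partitions: each edge sees one, and they
  would meet only at the missing corner. The unequal thresholds do the forcing: the exceptional sets
  of all rows together still miss a column, and that column is too long for a countable exceptional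
  set to exhaust it. Both thresholds are closed under countable unions, so nearby fibres carry
  exactly the same function, and constructions on \<open>K\<close> glue without any continuity of
  the choices involved. Blocks of length two in two offset positions suffice because grid neighbours
  always share a block of one kind; boundedly many steps are invisible in the limit, whereas
  opposite faces, \<open>N\<close> steps apart, stay separated.\<close>

definition ultra :: "'a filter \<Rightarrow> bool" where
  "ultra u \<longleftrightarrow> u \<noteq> bot \<and> (\<forall>P. eventually P u \<or> eventually (\<lambda>x. \<not> P x) u)"

lemma ultra_not_bot: "ultra u \<Longrightarrow> u \<noteq> bot"
  by (simp add: ultra_def)

lemma ultra_not_iff: "ultra u \<Longrightarrow> eventually (\<lambda>x. \<not> P x) u \<longleftrightarrow> \<not> eventually P u"
proof
  assume u: "ultra u" and n: "eventually (\<lambda>x. \<not> P x) u"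
  show "\<not> eventually P u"
  proof
    assume "eventually P u"
    with n have "eventually (\<lambda>x. False) u"
      by eventually_elim simp
    with ultra_not_bot[OF u] show False by simp
  qed
qed (auto simp: ultra_def)

lemma ultra_filtermap: "ultra u \<Longrightarrow> ultra (filtermap f u)"
  unfolding ultra_def eventually_filtermap by (auto simp: filtermap_bot_iff)

lemma ultra_finite:
  assumes "ultra u" "finite A" "eventually (\<lambda>x. \<exists>y\<in>A. Q y x) u"
  shows "\<exists>y\<in>A. eventually (Q y) u"
proof (rule ccontr)
  assume "\<not> ?thesis"
  then have "\<forall>y\<in>A. eventually (\<lambda>x. \<not> Q y x) u"
    using ultra_not_iff[OF assms(1)] by blast
  then have "eventually (\<lambda>x. \<forall>y\<in>A. \<not> Q y x) u"
    using assms(2) by (simp add: eventually_ball_finite)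
  then have "eventually (\<lambda>x. False) u"
    using assms(3) by eventually_elim auto
  then show False
    using ultra_not_bot[OF assms(1)] by simp
qed

lemma ultra_finite_range:
  assumes "ultra u" "finite A" "eventually (\<lambda>x. f x \<in> A) u"
  shows "\<exists>y\<in>A. eventually (\<lambda>x. f x = y) u"
  using ultra_finite[OF assms(1,2), of "\<lambda>y x. f x = y"] assms(3) by simp

lemma ultra_le_if_compatible:
  assumes "ultra u" "inf G u \<noteq> bot"
  shows "u \<le> G"
proof (rule filter_leI)
  fix P assume P: "eventually P G"
  show "eventually P u"
  proof (rule ccontr)
    assume "\<not> eventually P u"
    then have "eventually (\<lambda>x. \<not> P x) u"
      using ultra_not_iff[OF assms(1)] by blast
    with P have "eventually (\<lambda>x. False) (inf G u)"
      unfolding eventually_inf by blast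
    with assms(2) show False by simp
  qed
qed

lemma ultra_exists:
  fixes F :: "'a filter"
  assumes "F \<noteq> bot"
  obtains u where "u \<le> F" "ultra u"
proof -
  let ?A = "{G. G \<le> F \<and> G \<noteq> bot}"
  have "\<exists>m\<in>?A. \<forall>G\<in>?A. m \<ge> G \<longrightarrow> G = m"
  proof (rule predicate_Zorn)
    show "partial_order_on ?A (relation_of (\<ge>) ?A)"
      by (auto simp: partial_order_on_def preorder_on_def refl_on_def trans_def antisym_def
          relation_of_def)
    fix C assume C: "C \<in> Chains (relation_of (\<ge>) ?A)"
    then have sub: "C \<subseteq> ?A"
      by (auto simp: Chains_def relation_of_def)
    \<comment> \<open>Finite subfamilies of a chain have a least member, so the meet of the chain
      with \<open>F\<close> stays proper; inserting \<open>F\<close> covers the empty chain.\<close>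
    have fin: "Inf (insert F Y) \<in> insert F C" if "finite Y" "Y \<subseteq> C" for Y
      using that
    proof (induction Y)
      case (insert x Y)
      then have "Inf (insert F Y) \<in> insert F C" "x \<in> C" by auto
      moreover have "x \<le> y \<or> y \<le> x" if "y \<in> C" for y
        using C that \<open>x \<in> C\<close> by (auto simp: Chains_def relation_of_def)
      moreover have "x \<le> F" using sub \<open>x \<in> C\<close> by auto
      ultimately have "inf x (Inf (insert F Y)) \<in> insert F C"
        by (metis inf.absorb1 inf.absorb2 insert_iff)
      then show ?case
        by (simp add: inf_left_commute)
    qed auto
    have "Inf (insert F C) \<noteq> bot"
    proof (rule Inf_filter_not_bot)
      fix Y assume Y: "Y \<subseteq> insert F C" "finite Y"
      have "Inf (insert F (Y - {F})) \<in> insert F C"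
        using Y by (intro fin) auto
      then have "Inf (insert F (Y - {F})) \<noteq> bot"
        using sub assms by auto
      moreover have "Inf (insert F (Y - {F})) \<le> Inf Y"
        by (rule Inf_superset_mono) auto
      ultimately show "Inf Y \<noteq> bot"
        by (metis bot.extremum_uniqueI)
    qed
    then show "\<exists>u\<in>?A. \<forall>a\<in>C. a \<ge> u"
      by (intro bexI[of _ "Inf (insert F C)"]) (auto intro: Inf_lower le_infI2)
  qed
  then obtain m where m: "m \<le> F" "m \<noteq> bot" and
    min: "\<And>G. G \<le> F \<Longrightarrow> G \<noteq> bot \<Longrightarrow> G \<le> m \<Longrightarrow> G = m"
    by auto
  have "eventually P m \<or> eventually (\<lambda>x. \<not> P x) m" for P
  proof (cases "inf m (principal {x. P x}) = bot")
    case True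
    then have "eventually (\<lambda>x. False) (inf m (principal {x. P x}))"
      by simp
    then show ?thesis
      unfolding eventually_inf_principal by simp
  next
    case False
    then have "inf m (principal {x. P x}) = m"
      using m by (intro min) (auto intro: le_infI1)
    then have "eventually P m"
      using eventually_inf_principal[of P m "{x. P x}"] by simp
    then show ?thesis ..
  qed
  with m that show thesis
    unfolding ultra_def by blast
qed

text \<open>A filter is the join of the ultrafilters below it, so eventual statements and limits can
  be tested on those ultrafilters.\<close>

lemma eventually_if_all_ultra:
  assumes "\<And>u. ultra u \<Longrightarrow> u \<le> F \<Longrightarrow> eventually P u"
  shows "eventually P F"
proof (rule ccontr)
  assume "\<not> eventually P F"
  then have "inf F (principal {x. \<not> P x}) \<noteq> bot"
    by (auto simp: trivial_limit_def eventually_inf_principal)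
  then obtain u where u: "u \<le> inf F (principal {x. \<not> P x})" "ultra u"
    by (rule ultra_exists)
  have "eventually (\<lambda>x. \<not> P x) u"
    using u(1) by (auto intro!: filter_leD[OF u(1)] simp: eventually_inf_principal)
  moreover have "eventually P u"
    using u by (intro assms) auto
  ultimately show False
    using ultra_not_iff[OF u(2)] by blast
qed

text \<open>Compactness of the space of ultrafilters below \<open>F\<close>: if no finite subfamily
  sufficed, the complements would generate a proper filter together with \<open>F\<close>, and an
  ultrafilter below it would avoid every \<open>B i\<close>.\<close>

lemma ultra_finite_cover:
  assumes "\<And>u. ultra u \<Longrightarrow> u \<le> F \<Longrightarrow> \<exists>i\<in>J. eventually (B i) u"
  shows "\<exists>J'. finite J' \<and> J' \<subseteq> J \<and> eventually (\<lambda>x. \<exists>i\<in>J'. B i x) F"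
proof -
  have "inf F (INF i\<in>J. principal {x. \<not> B i x}) = bot"
  proof (rule ccontr)
    assume "\<not> ?thesis"
    then obtain u where u: "u \<le> inf F (INF i\<in>J. principal {x. \<not> B i x})" "ultra u"
      using ultra_exists by blast
    then obtain i where i: "i \<in> J" "eventually (B i) u"
      using assms[of u] by auto
    have "u \<le> (INF i\<in>J. principal {x. \<not> B i x})"
      using u(1) by simp
    also have "\<dots> \<le> principal {x. \<not> B i x}"
      using i by (auto intro: INF_lower)
    finally have "eventually (\<lambda>x. \<not> B i x) u"
      by (simp add: le_principal)
    then show False
      using ultra_not_iff[OF u(2)] i by blast
  qed
  then have "eventually (\<lambda>x. False) (inf F (INF i\<in>J. principal {x. \<not> B i x}))"
    by simp
  then obtain P Q where PQ: "eventually P F" "eventually Q (INF i\<in>J. principal {x. \<not> B i x})"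
    "\<And>x. P x \<Longrightarrow> \<not> Q x"
    unfolding eventually_inf by blast
  from PQ(2) obtain J' where "finite J'" "J' \<subseteq> J"
    "eventually Q (INF i\<in>J'. principal {x. \<not> B i x})"
    unfolding eventually_INF[of _ _ J] by blast
  then have "\<And>x. (\<forall>i\<in>J'. \<not> B i x) \<Longrightarrow> Q x"
    by (auto simp: INF_principal_finite eventually_principal)
  then have "eventually (\<lambda>x. \<exists>i\<in>J'. B i x) F"
    using PQ(1,3) by (auto elim!: eventually_mono)
  with \<open>finite J'\<close> \<open>J' \<subseteq> J\<close> show ?thesis by blast
qed

text \<open>The image ultrafilter has a cluster point in the compact interval, and ultrafilters
  converge to their cluster points. So \<open>Lim u g\<close> is the value at \<open>u\<close> of
  the extension of a bounded \<open>g\<close> to ultrafilters.\<close>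

lemma ultra_bounded_tendsto:
  fixes g :: "'a \<Rightarrow> real"
  assumes "ultra u" "\<And>x. \<bar>g x\<bar> \<le> M"
  shows "(g \<longlongrightarrow> Lim u g) u"
proof -
  have "compact {-M..M}" by simp
  moreover have "filtermap g u \<noteq> bot"
    using ultra_not_bot[OF assms(1)] by (simp add: filtermap_bot_iff)
  moreover have "eventually (\<lambda>y. y \<in> {-M..M}) (filtermap g u)"
    unfolding eventually_filtermap using assms(2) by (auto simp: abs_le_iff minus_le_iff)
  ultimately obtain l where "inf (nhds l) (filtermap g u) \<noteq> bot"
    unfolding compact_filter by blast
  then have "(g \<longlongrightarrow> l) u"
    unfolding filterlim_def by (rule ultra_le_if_compatible[OF ultra_filtermap[OF assms(1)]])
  then show ?thesis
    using tendsto_Lim[OF ultra_not_bot[OF assms(1)]] by blast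
qed

text \<open>Lets a parameter tend to infinity so slowly that at level \<open>N\<close> its current
  requirement already holds.\<close>

lemma diagonal_sequence:
  assumes "\<And>k::nat. eventually (P k) sequentially"
  obtains \<kappa> :: "nat \<Rightarrow> nat" where "filterlim \<kappa> at_top sequentially"
    "eventually (\<lambda>N. P (\<kappa> N) N) sequentially"
proof -
  \<comment> \<open>The alternative \<open>k = 0\<close> keeps the set nonempty at the early levels;
    it is harmless once \<open>P 0 N\<close> holds.\<close>
  define \<kappa> where "\<kappa> N = Max {k. k \<le> N \<and> (k = 0 \<or> P k N)}" for N
  have ne: "finite {k. k \<le> N \<and> (k = 0 \<or> P k N)}" "{k. k \<le> N \<and> (k = 0 \<or> P k N)} \<noteq> {}" for N
    by auto
  have "eventually (\<lambda>N. j \<le> \<kappa> N) sequentially" for j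
    using assms[of j] eventually_ge_at_top[of j]
  proof eventually_elim
    case (elim N)
    then show ?case
      unfolding \<kappa>_def by (intro Max_ge) auto
  qed
  then have "filterlim \<kappa> at_top sequentially"
    unfolding filterlim_at_top by blast
  moreover have "eventually (\<lambda>N. P (\<kappa> N) N) sequentially"
    using assms[of 0]
  proof eventually_elim
    case (elim N)
    then show ?case
      using Max_in[OF ne[of N]] unfolding \<kappa>_def[symmetric] by auto
  qed
  ultimately show thesis
    by (rule that)
qed


subsection \<open>The plank\<close>

datatype plank = Inner real "real set" | Side real | Roof "real set"

text \<open>\<open>nb t P\<close> means that \<open>P\<close> holds on a neighbourhood of \<open>t\<close>. The row of a point \<open>Side \<alpha>\<close> has more
  than continuum many points and the column of a point \<open>Roof \<gamma>\<close> uncountably many.\<close>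

fun nb :: "plank \<Rightarrow> (plank \<Rightarrow> bool) \<Rightarrow> bool" where
  "nb (Inner \<alpha> \<gamma>) P \<longleftrightarrow> P (Inner \<alpha> \<gamma>)"
| "nb (Side \<alpha>) P \<longleftrightarrow> P (Side \<alpha>) \<and> {\<gamma>. \<not> P (Inner \<alpha> \<gamma>)} \<lesssim> (UNIV :: real set)"
| "nb (Roof \<gamma>) P \<longleftrightarrow> P (Roof \<gamma>) \<and> countable {\<alpha>. \<not> P (Inner \<alpha> \<gamma>)}"

lemma real_times_real_lepoll: "(UNIV :: real set) \<times> (UNIV :: real set) \<lesssim> (UNIV :: real set)"
  using card_of_Times_same_infinite[OF infinite_UNIV_char_0[where 'a = real]]
  by (metis eqpoll_iff_card_of_ordIso eqpoll_imp_lepoll)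

lemma UN_lepoll_real:
  fixes E :: "real \<Rightarrow> 'b set"
  assumes "\<And>i. E i \<lesssim> (UNIV :: real set)"
  shows "(\<Union>i. E i) \<lesssim> (UNIV :: real set)"
proof -
  have "\<exists>f. \<forall>i. E i \<subseteq> f i ` (UNIV :: real set)"
    using assms unfolding lepoll_iff by metis
  then obtain f where f: "\<And>i. E i \<subseteq> f i ` (UNIV :: real set)"
    by blast
  then have "(\<Union>i. E i) \<subseteq> (\<lambda>(i, r). f i r) ` (UNIV \<times> UNIV)"
    by fastforce
  then have "(\<Union>i. E i) \<lesssim> (UNIV :: real set) \<times> (UNIV :: real set)"
    by (rule subset_image_lepoll)
  then show ?thesis
    using real_times_real_lepoll lepoll_trans by blast
qed

lemma countable_lepoll_real: "countable A \<Longrightarrow> A \<lesssim> (UNIV :: real set)"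
proof -
  assume "countable A"
  then have "A \<lesssim> (UNIV :: nat set)"
    by (metis countable_def lepoll_def subset_UNIV)
  also have "(UNIV :: nat set) \<lesssim> (UNIV :: real set)"
    by (simp add: infinite_le_lepoll[symmetric] infinite_UNIV_char_0)
  finally show ?thesis .
qed

lemma nb_self: "nb t P \<Longrightarrow> P t"
  by (cases t) auto

lemma nb_mono: "nb t P \<Longrightarrow> (\<And>s. P s \<Longrightarrow> Q s) \<Longrightarrow> nb t Q"
proof (cases t)
  case (Side \<alpha>)
  assume "nb t P" "\<And>s. P s \<Longrightarrow> Q s"
  then have "{\<gamma>. \<not> Q (Inner \<alpha> \<gamma>)} \<subseteq> {\<gamma>. \<not> P (Inner \<alpha> \<gamma>)}" by blast
  then have "{\<gamma>. \<not> Q (Inner \<alpha> \<gamma>)} \<lesssim> {\<gamma>. \<not> P (Inner \<alpha> \<gamma>)}"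
    by (rule subset_imp_lepoll)
  with \<open>nb t P\<close> \<open>\<And>s. P s \<Longrightarrow> Q s\<close> show ?thesis
    using Side lepoll_trans by auto
next
  case (Roof \<gamma>)
  assume "nb t P" "\<And>s. P s \<Longrightarrow> Q s"
  then have "{\<alpha>. \<not> Q (Inner \<alpha> \<gamma>)} \<subseteq> {\<alpha>. \<not> P (Inner \<alpha> \<gamma>)}" by blast
  with \<open>nb t P\<close> \<open>\<And>s. P s \<Longrightarrow> Q s\<close> show ?thesis
    using Roof countable_subset by auto
qed auto

text \<open>The P-space property: both kinds of exceptional sets are closed under countable
  unions.\<close>

lemma nb_all_nat:
  assumes "\<And>n::nat. nb t (P n)"
  shows "nb t (\<lambda>s. \<forall>n. P n s)"
proof (cases t)
  case (Side \<alpha>)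
  \<comment> \<open>\<open>UN_lepoll_real\<close> expects a family indexed by the reals, so the
    natural index is obtained by rounding down.\<close>
  have "(\<Union>i::real. {\<gamma>. \<not> P (nat \<lfloor>i\<rfloor>) (Inner \<alpha> \<gamma>)}) \<lesssim> (UNIV :: real set)"
    by (rule UN_lepoll_real) (use assms Side in auto)
  moreover have "{\<gamma>. \<not> (\<forall>n. P n (Inner \<alpha> \<gamma>))} \<subseteq> (\<Union>i::real. {\<gamma>. \<not> P (nat \<lfloor>i\<rfloor>) (Inner \<alpha> \<gamma>)})"
  proof
    fix \<gamma> assume "\<gamma> \<in> {\<gamma>. \<not> (\<forall>n. P n (Inner \<alpha> \<gamma>))}"
    then obtain n where "\<not> P n (Inner \<alpha> \<gamma>)" by blast
    then show "\<gamma> \<in> (\<Union>i::real. {\<gamma>. \<not> P (nat \<lfloor>i\<rfloor>) (Inner \<alpha> \<gamma>)})"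
      by (intro UN_I[of "real n"]) auto
  qed
  ultimately have "{\<gamma>. \<not> (\<forall>n. P n (Inner \<alpha> \<gamma>))} \<lesssim> (UNIV :: real set)"
    using lepoll_trans subset_imp_lepoll by blast
  then show ?thesis
    using assms Side by simp
next
  case (Roof \<gamma>)
  have "{\<alpha>. \<not> (\<forall>n. P n (Inner \<alpha> \<gamma>))} = (\<Union>n. {\<alpha>. \<not> P n (Inner \<alpha> \<gamma>)})"
    by blast
  with assms Roof show ?thesis by auto
qed (use assms in auto)

lemma nb_True [simp]: "nb t (\<lambda>s. True)"
  by (cases t) auto

lemma nb_conj:
  assumes "nb t P" "nb t Q"
  shows "nb t (\<lambda>s. P s \<and> Q s)"
proof -
  have "nb t (\<lambda>s. \<forall>n::nat. if n = 0 then P s else Q s)"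
  proof (rule nb_all_nat)
    show "nb t (\<lambda>s. if n = 0 then P s else Q s)" for n :: nat
      using assms by (cases "n = 0") auto
  qed
  then show ?thesis
    by (rule nb_mono) (metis zero_neq_one)
qed

lemma nb_ball_finite:
  assumes "finite A" "\<And>i. i \<in> A \<Longrightarrow> nb t (P i)"
  shows "nb t (\<lambda>s. \<forall>i\<in>A. P i s)"
  using assms by (induction A) (auto intro: nb_conj)

lemma nb_near: "nb t (\<lambda>s. s = t \<or> (\<exists>\<alpha> \<gamma>. s = Inner \<alpha> \<gamma>))"
  by (cases t) auto

lemma nb_neq: "s \<noteq> t \<Longrightarrow> nb t (\<lambda>r. r \<noteq> s)"
proof (cases t)
  case (Side \<alpha>)
  assume "s \<noteq> t"
  have "countable {\<gamma>. Inner \<alpha> \<gamma> = s}"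
    by (rule countable_subset[of _ "case s of Inner _ \<gamma> \<Rightarrow> {\<gamma>} | _ \<Rightarrow> {}"]) (auto split: plank.splits)
  with Side \<open>s \<noteq> t\<close> show ?thesis using countable_lepoll_real by auto
next
  case (Roof \<gamma>)
  assume "s \<noteq> t"
  have "countable {\<alpha>. Inner \<alpha> \<gamma> = s}"
    by (rule countable_subset[of _ "case s of Inner \<alpha> _ \<Rightarrow> {\<alpha>} | _ \<Rightarrow> {}"]) (auto split: plank.splits)
  with Roof \<open>s \<noteq> t\<close> show ?thesis by auto
qed auto

text \<open>Rows and columns of different edge points meet in at most one point. A set consisting of
  \<open>t\<close> and part of its row or column is thus negligible near every other edge point,
  hence clopen.\<close>

lemma nb_clopen:
  assumes "nb t P"
  obtains V where "\<And>s. s \<in> V \<Longrightarrow> P s" "t \<in> V" "\<And>s. s \<in> V \<Longrightarrow> s = t \<or> (\<exists>\<alpha> \<gamma>. s = Inner \<alpha> \<gamma>)"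
    "\<And>r. nb r (\<lambda>s. s \<in> V \<longleftrightarrow> r \<in> V)"
proof -
  define row where "row = (case t of Inner \<alpha> \<gamma> \<Rightarrow> {} | Side \<alpha> \<Rightarrow> range (Inner \<alpha>) | Roof \<gamma> \<Rightarrow> range (\<lambda>\<alpha>. Inner \<alpha> \<gamma>))"
  define V where "V = insert t (row \<inter> {s. P s})"
  have row_inner: "\<exists>\<alpha> \<gamma>. s = Inner \<alpha> \<gamma>" if "s \<in> row" for s
    using that unfolding row_def by (auto split: plank.splits)
  have row_near: "nb t (\<lambda>s. s \<in> insert t row)"
    unfolding row_def by (cases t) auto
  have far: "nb r (\<lambda>s. s \<notin> V)" if "r \<notin> V" for r
  proof (cases r)
    case (Side \<alpha>)
    have "countable {\<gamma>. Inner \<alpha> \<gamma> \<in> insert t row}"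
    proof (rule countable_subset)
      show "{\<gamma>. Inner \<alpha> \<gamma> \<in> insert t row} \<subseteq> (case t of Inner \<alpha> \<gamma> \<Rightarrow> {\<gamma>} | Side \<alpha> \<Rightarrow> {} | Roof \<gamma> \<Rightarrow> {\<gamma>})"
        using that Side unfolding row_def V_def by (auto split: plank.splits)
    qed (auto split: plank.splits)
    then have "countable {\<gamma>. Inner \<alpha> \<gamma> \<in> V}"
      by (rule countable_subset[rotated]) (auto simp: V_def)
    then show ?thesis
      using that Side countable_lepoll_real by simp
  next
    case (Roof \<gamma>)
    have "countable {\<alpha>. Inner \<alpha> \<gamma> \<in> insert t row}"
    proof (rule countable_subset)
      show "{\<alpha>. Inner \<alpha> \<gamma> \<in> insert t row} \<subseteq> (case t of Inner \<alpha> \<gamma> \<Rightarrow> {\<alpha>} | Side \<alpha> \<Rightarrow> {\<alpha>} | Roof \<gamma> \<Rightarrow> {})"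
        using that Roof unfolding row_def V_def by (auto split: plank.splits)
    qed (auto split: plank.splits)
    then have "countable {\<alpha>. Inner \<alpha> \<gamma> \<in> V}"
      by (rule countable_subset[rotated]) (auto simp: V_def)
    then show ?thesis
      using that Roof by simp
  qed (use that in simp)
  have near: "nb r (\<lambda>s. s \<in> V)" if "r \<in> V" for r
  proof (cases "r = t")
    case True
    show ?thesis
      unfolding True using nb_conj[OF row_near assms] by (rule nb_mono) (auto simp: V_def)
  next
    case False
    then show ?thesis
      using that row_inner[of r] by (auto simp: V_def)
  qed
  show thesis
  proof (rule that[of V])
    show "nb r (\<lambda>s. s \<in> V \<longleftrightarrow> r \<in> V)" for r
      using near[of r] far[of r] by (cases "r \<in> V") auto
  qed (use nb_self[OF assms] row_inner in \<open>auto simp: V_def\<close>)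
qed

text \<open>At most continuum many columns are exceptional for some row, and by Cantor there are
  more columns than that. The chosen column is uncountable, so some point of it agrees with its top.
  Since \<open>D\<close> may have values in any type, this applies to whole families of functions at
  once.\<close>

lemma plank_locally_constant:
  assumes "\<And>t. nb t (\<lambda>s. D s = D t)"
  obtains \<alpha> \<gamma> where "D (Side \<alpha>) = D (Inner \<alpha> \<gamma>)" "D (Roof \<gamma>) = D (Inner \<alpha> \<gamma>)"
proof -
  have "(\<Union>\<alpha>. {\<gamma>. D (Inner \<alpha> \<gamma>) \<noteq> D (Side \<alpha>)}) \<lesssim> (UNIV :: real set)"
    by (rule UN_lepoll_real) (use assms[of "Side _"] in auto)
  moreover have "\<not> (UNIV :: real set set) \<lesssim> (UNIV :: real set)"
    using lesspoll_trans2[OF lesspoll_Pow_self[of "UNIV :: real set"]] lesspoll_not_refl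
    unfolding Pow_UNIV by blast
  ultimately have "(\<Union>\<alpha>. {\<gamma>. D (Inner \<alpha> \<gamma>) \<noteq> D (Side \<alpha>)}) \<noteq> UNIV"
    by (auto simp del: UN_iff)
  then obtain \<gamma> where \<gamma>: "\<And>\<alpha>. D (Inner \<alpha> \<gamma>) = D (Side \<alpha>)"
    by auto
  have "countable {\<alpha>. D (Inner \<alpha> \<gamma>) \<noteq> D (Roof \<gamma>)}"
    using assms[of "Roof \<gamma>"] by auto
  then have "{\<alpha>. D (Inner \<alpha> \<gamma>) \<noteq> D (Roof \<gamma>)} \<noteq> UNIV"
    using uncountable_UNIV_real by auto
  then obtain \<alpha> where "D (Inner \<alpha> \<gamma>) = D (Roof \<gamma>)"
    by auto
  with \<gamma> show thesis by (intro that[of \<alpha> \<gamma>]) auto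
qed


subsection \<open>The space over the plank\<close>

text \<open>A partition is given by the idempotent map that sends an index to the representative of
  its block; preserving \<open>lev\<close> makes the map act on \<open>K\<close>.\<close>

locale two_partitions =
  fixes lev :: "'i \<Rightarrow> nat" and a b :: "'i \<Rightarrow> 'i"
  assumes lev_a: "lev (a x) = lev x" and lev_b: "lev (b x) = lev x"
    and a_idem: "a (a x) = a x" and b_idem: "b (b x) = b x"
begin

definition F :: "'i filter" where
  "F = filtercomap lev sequentially"

definition K :: "'i filter set" where
  "K = {u. ultra u \<and> u \<le> F}"

fun e :: "plank \<Rightarrow> 'i \<Rightarrow> 'i" where
  "e (Inner \<alpha> \<gamma>) = id"
| "e (Side \<alpha>) = a"
| "e (Roof \<gamma>) = b"

text \<open>The quotient of \<open>K\<close> under an idempotent map is identified with the set of ultrafilters fixed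
  by that map.\<close>

definition pts :: "(plank \<times> 'i filter) set" where
  "pts = {(t, u). u \<in> K \<and> filtermap (e t) u = u}"

text \<open>Near \<open>t\<close> every fibre is mapped to the fibre over \<open>t\<close> by
  \<open>filtermap (e t)\<close>. A basic neighbourhood is the preimage of the clopen set of
  ultrafilters containing \<open>B\<close>, and composing \<open>B\<close> with \<open>e t\<close>
  expresses this preimage.\<close>

definition plank_space :: "(plank \<times> 'i filter) topology" where
  "plank_space = topology (\<lambda>W. W \<subseteq> pts \<and> (\<forall>t u. (t, u) \<in> W \<longrightarrow> (\<exists>B. eventually B u \<and>
     nb t (\<lambda>s. \<forall>w. (s, w) \<in> pts \<longrightarrow> eventually (\<lambda>x. B (e t x)) w \<longrightarrow> (s, w) \<in> W))))"

text \<open>Continuity for the Stone topology, whose base consists of the sets of ultrafilters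
  containing a given \<open>B\<close>.\<close>

definition contK :: "('i filter \<Rightarrow> real) \<Rightarrow> bool" where
  "contK g \<longleftrightarrow> (\<forall>u\<in>K. \<forall>\<epsilon>>0. \<exists>B. eventually B u \<and> (\<forall>w\<in>K. eventually B w \<longrightarrow> \<bar>g w - g u\<bar> < \<epsilon>))"

text \<open>By \<open>continuous_if_compatible\<close> and \<open>compatible_if_continuous\<close>, the compatible families are
  the continuous functions, each pulled back from the fibre over \<open>t\<close> to \<open>K\<close>.\<close>

definition compatible :: "(plank \<Rightarrow> 'i filter \<Rightarrow> real) \<Rightarrow> bool" where
  "compatible \<phi> \<longleftrightarrow> (\<forall>t. contK (\<phi> t) \<and> (\<forall>u\<in>K. \<phi> t (filtermap (e t) u) = \<phi> t u) \<and>
     nb t (\<lambda>s. \<forall>u\<in>K. \<phi> s u = \<phi> t u))"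

lemma lev_e [simp]: "lev (e t x) = lev x"
  by (cases t) (auto simp: lev_a lev_b)

lemma e_idem [simp]: "e t (e t x) = e t x"
  by (cases t) (auto simp: a_idem b_idem)

lemma e_near: "nb t (\<lambda>s. \<forall>x. e t (e s x) = e t x)"
  using nb_near[of t] by (rule nb_mono) auto

lemma K_ultra: "u \<in> K \<Longrightarrow> ultra u"
  by (simp add: K_def)

lemma K_eventually: "u \<in> K \<Longrightarrow> eventually P F \<Longrightarrow> eventually P u"
  by (auto simp: K_def le_filter_def)

lemma K_filtermap:
  assumes "u \<in> K" "\<And>x. lev (f x) = lev x"
  shows "filtermap f u \<in> K"
  using assms unfolding K_def F_def
  by (simp add: ultra_filtermap filtermap_le_iff_le_filtercomap[symmetric] filtermap_filtermap)

lemma filtermap_e_e [simp]: "filtermap (e t) (filtermap (e t) u) = filtermap (e t) u"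
  by (simp add: filtermap_filtermap)

lemma filtermap_e_pts: "u \<in> K \<Longrightarrow> (t, filtermap (e t) u) \<in> pts"
  by (simp add: pts_def K_filtermap)

lemma eventually_F_if_K: "(\<And>u. u \<in> K \<Longrightarrow> eventually P u) \<Longrightarrow> eventually P F"
  by (rule eventually_if_all_ultra) (simp add: K_def)

lemma tendsto_F_if_K:
  assumes "\<And>u. u \<in> K \<Longrightarrow> (g \<longlongrightarrow> l) u"
  shows "(g \<longlongrightarrow> l) F"
  unfolding tendsto_def using assms by (auto intro!: eventually_F_if_K topological_tendstoD)

lemma tendsto_K: "u \<in> K \<Longrightarrow> (g \<longlongrightarrow> l) F \<Longrightarrow> (g \<longlongrightarrow> l) u"
  unfolding K_def by (auto intro: tendsto_mono)

lemma eventually_F_iff: "eventually P F \<longleftrightarrow> eventually (\<lambda>N. \<forall>x. lev x = N \<longrightarrow> P x) sequentially"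
  unfolding F_def eventually_filtercomap
proof
  assume "\<exists>Q. eventually Q sequentially \<and> (\<forall>x. Q (lev x) \<longrightarrow> P x)"
  then show "eventually (\<lambda>N. \<forall>x. lev x = N \<longrightarrow> P x) sequentially"
    by (auto elim: eventually_mono)
qed blast

lemma eventually_F_lev: "eventually P sequentially \<Longrightarrow> eventually (\<lambda>x. P (lev x)) F"
  unfolding F_def eventually_filtercomap by blast

lemma filterlim_F_lev: "filterlim \<kappa> G sequentially \<Longrightarrow> filterlim (\<lambda>x. \<kappa> (lev x)) G F"
  unfolding F_def by (rule filterlim_compose[OF _ filterlim_filtercomap])

section \<open>Continuous functions on \<open>K\<close> as limits of functions on the index
  set\<close>

lemma contK_Lim:
  assumes "\<And>x. \<bar>h x\<bar> \<le> M"
  shows "contK (\<lambda>u. Lim u h)"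
  unfolding contK_def
proof (intro ballI allI impI)
  fix u and \<epsilon> :: real assume "u \<in> K" "\<epsilon> > 0"
  let ?B = "\<lambda>x. \<bar>h x - Lim u h\<bar> < \<epsilon> / 2"
  have "eventually ?B u"
    using tendstoD[OF ultra_bounded_tendsto[OF K_ultra[OF \<open>u \<in> K\<close>] assms], of "\<epsilon>/2"] \<open>\<epsilon> > 0\<close>
    by (simp add: dist_real_def)
  moreover have "\<bar>Lim w h - Lim u h\<bar> < \<epsilon>" if "w \<in> K" "eventually ?B w" for w
  proof -
    have "((\<lambda>x. \<bar>h x - Lim u h\<bar>) \<longlongrightarrow> \<bar>Lim w h - Lim u h\<bar>) w"
      by (intro tendsto_intros ultra_bounded_tendsto[OF K_ultra[OF \<open>w \<in> K\<close>] assms])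
    then have "\<bar>Lim w h - Lim u h\<bar> \<le> \<epsilon> / 2"
      by (rule tendsto_upperbound)
        (use that ultra_not_bot[OF K_ultra] in \<open>auto elim!: eventually_mono\<close>)
    with \<open>\<epsilon> > 0\<close> show ?thesis by simp
  qed
  ultimately show "\<exists>B. eventually B u \<and> (\<forall>w\<in>K. eventually B w \<longrightarrow> \<bar>Lim w h - Lim u h\<bar> < \<epsilon>)"
    by blast
qed

text \<open>Compactness yields finitely many clopen sets on each of which \<open>g\<close> stays
  close to a constant; \<open>h\<close> is the resulting step function.\<close>

lemma contK_step_approximation:
  assumes "contK g" "\<delta> > 0"
  shows "\<exists>h. \<forall>u\<in>K. eventually (\<lambda>x. \<bar>h x - g u\<bar> < \<delta>) u"
proof -
  let ?J = "{(B, c). \<forall>w\<in>K. eventually B w \<longrightarrow> \<bar>g w - c\<bar> < \<delta>}"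
  have "\<exists>J'. finite J' \<and> J' \<subseteq> ?J \<and> eventually (\<lambda>x. \<exists>p\<in>J'. fst p x) F"
  proof (rule ultra_finite_cover)
    fix u :: "'i filter" assume "ultra u" "u \<le> F"
    then have "u \<in> K" by (simp add: K_def)
    with assms obtain B where "eventually B u" "\<forall>w\<in>K. eventually B w \<longrightarrow> \<bar>g w - g u\<bar> < \<delta>"
      unfolding contK_def by blast
    then show "\<exists>p\<in>?J. eventually (fst p) u"
      by (intro bexI[of _ "(B, g u)"]) auto
  qed
  then obtain J' where J': "finite J'" "J' \<subseteq> ?J" "eventually (\<lambda>x. \<exists>p\<in>J'. fst p x) F"
    by blast
  \<comment> \<open>The sets may overlap and may miss indices of low level. An arbitrary selection
    is still constant along each ultrafilter in \<open>K\<close>, because only finitely many sets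
    are available.\<close>
  define sel where "sel x = (SOME p. p \<in> J' \<and> fst p x)" for x
  have "eventually (\<lambda>x. \<bar>snd (sel x) - g u\<bar> < \<delta>) u" if u: "u \<in> K" for u
  proof -
    have ev: "eventually (\<lambda>x. sel x \<in> J' \<and> fst (sel x) x) u"
      using K_eventually[OF u J'(3)]
    proof eventually_elim
      case (elim x)
      then show ?case
        unfolding sel_def by (metis (mono_tags, lifting) someI_ex)
    qed
    then have "eventually (\<lambda>x. sel x \<in> J') u"
      by (rule eventually_mono) simp
    from ultra_finite_range[OF K_ultra[OF u] J'(1) this]
    obtain p where p: "p \<in> J'" "eventually (\<lambda>x. sel x = p) u" by blast
    with ev have "eventually (fst p) u"
      by (auto elim: eventually_elim2)
    then have "\<bar>snd p - g u\<bar> < \<delta>"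
      using p(1) J'(2) u by (fastforce simp: abs_minus_commute)
    with p(2) show ?thesis
      by (auto elim: eventually_mono)
  qed
  then show ?thesis
    by (intro exI[of _ "\<lambda>x. snd (sel x)"]) blast
qed

text \<open>The step approximations need not converge at a fixed index, but any two agree up to
  their errors on all high levels. Using at each level an approximation whose number grows slowly
  gives one function with exact limits.\<close>

lemma contK_lift:
  assumes "contK g"
  obtains h where "\<And>u. u \<in> K \<Longrightarrow> (h \<longlongrightarrow> g u) u"
proof -
  have "\<exists>h. \<forall>u\<in>K. eventually (\<lambda>x. \<bar>h x - g u\<bar> < 1 / real (Suc k)) u" for k
    by (rule contK_step_approximation[OF assms]) simp
  then obtain h where h: "\<And>k u. u \<in> K \<Longrightarrow> eventually (\<lambda>x. \<bar>h k x - g u\<bar> < 1 / real (Suc k)) u"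
    by metis
  have close: "eventually (\<lambda>x. \<bar>h k x - h j x\<bar> < 1 / real (Suc k) + 1 / real (Suc j)) F" for j k
  proof (rule eventually_F_if_K)
    fix u assume "u \<in> K"
    show "eventually (\<lambda>x. \<bar>h k x - h j x\<bar> < 1 / real (Suc k) + 1 / real (Suc j)) u"
      using h[OF \<open>u \<in> K\<close>, of k] h[OF \<open>u \<in> K\<close>, of j]
      by eventually_elim arith
  qed
  define P where "P k N \<longleftrightarrow> (\<forall>j\<le>k. \<forall>x. lev x = N \<longrightarrow> \<bar>h k x - h j x\<bar> < 1 / real (Suc k) + 1 / real (Suc j))"
    for k N
  have "eventually (P k) sequentially" for k
    unfolding P_def using close[unfolded eventually_F_iff]
    by (simp add: eventually_ball_finite[of "{..k}", unfolded Ball_def atMost_iff])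
  then obtain \<kappa> where \<kappa>: "filterlim \<kappa> at_top sequentially" "eventually (\<lambda>N. P (\<kappa> N) N) sequentially"
    by (rule diagonal_sequence)
  have "((\<lambda>x. h (\<kappa> (lev x)) x) \<longlongrightarrow> g u) u" if "u \<in> K" for u
  proof (rule tendstoI)
    fix \<epsilon> :: real assume "\<epsilon> > 0"
    \<comment> \<open>Two error terms come from comparing the diagonal function with
      \<open>h j\<close>, the third from comparing \<open>h j\<close> with
      \<open>g u\<close>.\<close>
    obtain j where j: "3 / real (Suc j) < \<epsilon>"
      using reals_Archimedean[of "\<epsilon> / 3"] \<open>\<epsilon> > 0\<close> by (auto simp: field_simps)
    have "eventually (\<lambda>N. j \<le> \<kappa> N) sequentially"
      using \<kappa>(1) by (simp add: filterlim_at_top)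
    then have "eventually (\<lambda>x. j \<le> \<kappa> (lev x)) u" "eventually (\<lambda>x. P (\<kappa> (lev x)) (lev x)) u"
      using \<kappa>(2) by (auto intro!: K_eventually[OF that] eventually_F_lev)
    then show "eventually (\<lambda>x. dist (h (\<kappa> (lev x)) x) (g u) < \<epsilon>) u"
      using h[OF that, of j]
    proof eventually_elim
      case (elim x)
      then have "\<bar>h (\<kappa> (lev x)) x - h j x\<bar> < 1 / real (Suc (\<kappa> (lev x))) + 1 / real (Suc j)"
        unfolding P_def by blast
      moreover have "1 / real (Suc (\<kappa> (lev x))) \<le> 1 / real (Suc j)"
        using elim by (simp add: field_simps)
      moreover have "3 / real (Suc j) = 1 / real (Suc j) + 1 / real (Suc j) + 1 / real (Suc j)"
        by (simp add: field_simps)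
      ultimately show ?case
        using elim j unfolding dist_real_def by linarith
    qed
  qed
  then show thesis by (rule that)
qed

section \<open>The topology of the total space and its real functions\<close>

lemma istopology_plank:
  "istopology (\<lambda>W. W \<subseteq> pts \<and> (\<forall>t u. (t, u) \<in> W \<longrightarrow> (\<exists>B. eventually B u \<and>
     nb t (\<lambda>s. \<forall>w. (s, w) \<in> pts \<longrightarrow> eventually (\<lambda>x. B (e t x)) w \<longrightarrow> (s, w) \<in> W))))"
  (is "istopology ?T")
  unfolding istopology_def
proof (rule conjI; intro allI impI)
  fix W W' assume W: "?T W" and W': "?T W'"
  show "?T (W \<inter> W')"
  proof (intro conjI allI impI)
    fix t u assume "(t, u) \<in> W \<inter> W'"
    with W W' obtain B B' where B: "eventually B u" "eventually B' u"
      "nb t (\<lambda>s. \<forall>w. (s, w) \<in> pts \<longrightarrow> eventually (\<lambda>x. B (e t x)) w \<longrightarrow> (s, w) \<in> W)"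
      "nb t (\<lambda>s. \<forall>w. (s, w) \<in> pts \<longrightarrow> eventually (\<lambda>x. B' (e t x)) w \<longrightarrow> (s, w) \<in> W')"
      by blast
    show "\<exists>B. eventually B u \<and>
      nb t (\<lambda>s. \<forall>w. (s, w) \<in> pts \<longrightarrow> eventually (\<lambda>x. B (e t x)) w \<longrightarrow> (s, w) \<in> W \<inter> W')"
      using B(1,2) nb_conj[OF B(3,4)]
      by (intro exI[of _ "\<lambda>x. B x \<and> B' x"]) (auto simp: eventually_conj_iff elim!: nb_mono)
  qed (use W in blast)
next
  fix \<W> assume *: "\<forall>W\<in>\<W>. ?T W"
  show "?T (\<Union>\<W>)"
  proof (intro conjI allI impI)
    fix t u assume "(t, u) \<in> \<Union>\<W>"
    then obtain W where "(t, u) \<in> W" "W \<in> \<W>" by blast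
    with * obtain B where "eventually B u"
      "nb t (\<lambda>s. \<forall>w. (s, w) \<in> pts \<longrightarrow> eventually (\<lambda>x. B (e t x)) w \<longrightarrow> (s, w) \<in> W)"
      by blast
    then show "\<exists>B. eventually B u \<and>
      nb t (\<lambda>s. \<forall>w. (s, w) \<in> pts \<longrightarrow> eventually (\<lambda>x. B (e t x)) w \<longrightarrow> (s, w) \<in> \<Union>\<W>)"
      using \<open>W \<in> \<W>\<close> by (intro exI[of _ B]) (auto elim!: nb_mono)
  qed (use * in blast)
qed

lemma openin_plank_space:
  "openin plank_space W \<longleftrightarrow> W \<subseteq> pts \<and> (\<forall>t u. (t, u) \<in> W \<longrightarrow> (\<exists>B. eventually B u \<and>
     nb t (\<lambda>s. \<forall>w. (s, w) \<in> pts \<longrightarrow> eventually (\<lambda>x. B (e t x)) w \<longrightarrow> (s, w) \<in> W)))"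
  unfolding plank_space_def topology_inverse'[OF istopology_plank] by simp

lemma topspace_plank_space [simp]: "topspace plank_space = pts"
proof -
  have "openin plank_space pts"
    unfolding openin_plank_space by (auto intro!: exI[of _ "\<lambda>x. True"])
  then show ?thesis
    by (metis openin_plank_space openin_subset openin_topspace subset_antisym)
qed

lemma continuous_if_compatible:
  assumes "compatible \<phi>" "\<And>t u. (t, u) \<in> pts \<Longrightarrow> f (t, u) = \<phi> t u"
  shows "continuous_map plank_space euclideanreal f"
  unfolding continuous_map_def
proof (intro conjI allI impI)
  fix U :: "real set" assume "openin euclidean U"
  then have U: "open U" by simp
  show "openin plank_space {x \<in> topspace plank_space. f x \<in> U}"
    unfolding openin_plank_space
  proof (intro conjI allI impI)
    fix t u assume "(t, u) \<in> {x \<in> topspace plank_space. f x \<in> U}"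
    then have tu: "(t, u) \<in> pts" "f (t, u) \<in> U" by auto
    then have u: "u \<in> K" "filtermap (e t) u = u" by (auto simp: pts_def)
    obtain \<epsilon> where "\<epsilon> > 0" and \<epsilon>: "\<And>y. \<bar>y - f (t, u)\<bar> < \<epsilon> \<Longrightarrow> y \<in> U"
      using U tu unfolding open_dist dist_real_def by blast
    obtain B where B: "eventually B u" "\<forall>w\<in>K. eventually B w \<longrightarrow> \<bar>\<phi> t w - \<phi> t u\<bar> < \<epsilon>"
      using assms(1) u \<open>\<epsilon> > 0\<close> unfolding compatible_def contK_def by blast
    have "nb t (\<lambda>s. \<forall>u\<in>K. \<phi> s u = \<phi> t u)"
      using assms(1) unfolding compatible_def by blast
    then have "nb t (\<lambda>s. \<forall>w. (s, w) \<in> pts \<longrightarrow> eventually (\<lambda>x. B (e t x)) w \<longrightarrow>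
        (s, w) \<in> {x \<in> topspace plank_space. f x \<in> U})"
    proof (rule nb_mono, intro allI impI)
      fix s w assume s: "\<forall>u\<in>K. \<phi> s u = \<phi> t u" and w: "(s, w) \<in> pts" "eventually (\<lambda>x. B (e t x)) w"
      then have "w \<in> K" by (simp add: pts_def)
      have "f (s, w) = \<phi> t w"
        using s w assms(2) \<open>w \<in> K\<close> by simp
      also have "\<dots> = \<phi> t (filtermap (e t) w)"
        using assms(1) \<open>w \<in> K\<close> unfolding compatible_def by simp
      finally have "\<bar>f (s, w) - f (t, u)\<bar> < \<epsilon>"
        using B(2) w tu assms(2) K_filtermap[OF \<open>w \<in> K\<close>, of "e t"] by (simp add: eventually_filtermap)
      then show "(s, w) \<in> {x \<in> topspace plank_space. f x \<in> U}"
        using w \<epsilon> by simp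
    qed
    with B(1) show "\<exists>B. eventually B u \<and>
      nb t (\<lambda>s. \<forall>w. (s, w) \<in> pts \<longrightarrow> eventually (\<lambda>x. B (e t x)) w \<longrightarrow> (s, w) \<in> {x \<in> topspace plank_space. f x \<in> U})"
      by blast
  qed auto
qed simp

text \<open>Compactness of \<open>K\<close> makes the neighbourhood of \<open>t\<close> on which a given accuracy holds independent
  of the ultrafilter, and in a P-space countably many accuracies can be met at once.\<close>

lemma compatible_if_continuous:
  assumes "continuous_map plank_space euclideanreal f"
  shows "compatible (\<lambda>t u. f (t, filtermap (e t) u))"
proof -
  have cont: "\<exists>B. eventually B u \<and> nb t (\<lambda>s. \<forall>w. (s, w) \<in> pts \<longrightarrow>
      eventually (\<lambda>x. B (e t x)) w \<longrightarrow> \<bar>f (s, w) - f (t, u)\<bar> < \<epsilon>)"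
    if "(t, u) \<in> pts" "\<epsilon> > 0" for t u and \<epsilon> :: real
  proof -
    have "openin plank_space {x \<in> topspace plank_space. f x \<in> ball (f (t, u)) \<epsilon>}"
      using assms by (rule openin_continuous_map_preimage) simp
    moreover have "(t, u) \<in> {x \<in> topspace plank_space. f x \<in> ball (f (t, u)) \<epsilon>}"
      using that by simp
    ultimately obtain B where "eventually B u" "nb t (\<lambda>s. \<forall>w. (s, w) \<in> pts \<longrightarrow>
      eventually (\<lambda>x. B (e t x)) w \<longrightarrow> (s, w) \<in> {x \<in> topspace plank_space. f x \<in> ball (f (t, u)) \<epsilon>})"
      unfolding openin_plank_space by blast
    then show ?thesis
      by (intro exI[of _ B]) (auto elim!: nb_mono simp: dist_real_def abs_minus_commute)
  qed
  show ?thesis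
    unfolding compatible_def
  proof (intro allI conjI)
    fix t
    show "contK (\<lambda>u. f (t, filtermap (e t) u))"
      unfolding contK_def
    proof (intro ballI allI impI)
      fix u and \<epsilon> :: real assume u: "u \<in> K" "\<epsilon> > 0"
      obtain B where B: "eventually B (filtermap (e t) u)"
        "nb t (\<lambda>s. \<forall>w. (s, w) \<in> pts \<longrightarrow> eventually (\<lambda>x. B (e t x)) w \<longrightarrow>
          \<bar>f (s, w) - f (t, filtermap (e t) u)\<bar> < \<epsilon>)"
        using cont[OF filtermap_e_pts[OF u(1)] u(2)] by blast
      show "\<exists>B. eventually B u \<and> (\<forall>w\<in>K. eventually B w \<longrightarrow>
          \<bar>f (t, filtermap (e t) w) - f (t, filtermap (e t) u)\<bar> < \<epsilon>)"
        using B(1) nb_self[OF B(2)] filtermap_e_pts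
        by (intro exI[of _ "\<lambda>x. B (e t x)"]) (simp add: eventually_filtermap)
    qed
    have approx: "nb t (\<lambda>s. \<forall>w\<in>K. \<bar>f (s, filtermap (e s) w) - f (t, filtermap (e t) w)\<bar> < 1 / real (Suc n))" for n
    proof -
      \<comment> \<open>Half the accuracy: the values over \<open>s\<close> and over
        \<open>t\<close> are both compared with the value at the centre \<open>fst p\<close> of one
        piece.\<close>
      define \<delta> where "\<delta> = 1 / real (Suc n) / 2"
      have "\<delta> > 0" by (simp add: \<delta>_def)
      define J where "J = {(u, B). nb t (\<lambda>s. \<forall>w. (s, w) \<in> pts \<longrightarrow>
          eventually (\<lambda>x. B (e t x)) w \<longrightarrow> \<bar>f (s, w) - f (t, u)\<bar> < \<delta>)}"
      have "\<exists>J'. finite J' \<and> J' \<subseteq> J \<and> eventually (\<lambda>x. \<exists>p\<in>J'. snd p (e t x)) F"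
      proof (rule ultra_finite_cover)
        fix u :: "'i filter" assume "ultra u" "u \<le> F"
        then have "(t, filtermap (e t) u) \<in> pts"
          by (intro filtermap_e_pts) (simp add: K_def)
        from cont[OF this \<open>\<delta> > 0\<close>] obtain B where "eventually B (filtermap (e t) u)"
          "(filtermap (e t) u, B) \<in> J"
          unfolding J_def by blast
        then show "\<exists>p\<in>J. eventually (\<lambda>x. snd p (e t x)) u"
          by (intro bexI[of _ "(filtermap (e t) u, B)"]) (auto simp: eventually_filtermap)
      qed
      then obtain J' where J': "finite J'" "J' \<subseteq> J" "eventually (\<lambda>x. \<exists>p\<in>J'. snd p (e t x)) F"
        by blast
      have "nb t (\<lambda>s. \<forall>p\<in>J'. \<forall>w. (s, w) \<in> pts \<longrightarrow>
          eventually (\<lambda>x. snd p (e t x)) w \<longrightarrow> \<bar>f (s, w) - f (t, fst p)\<bar> < \<delta>)"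
        using J' by (intro nb_ball_finite) (auto simp: J_def)
      from nb_conj[OF this e_near] show ?thesis
      proof (rule nb_mono, intro ballI, elim conjE)
        fix s w assume s: "\<forall>p\<in>J'. \<forall>w. (s, w) \<in> pts \<longrightarrow>
          eventually (\<lambda>x. snd p (e t x)) w \<longrightarrow> \<bar>f (s, w) - f (t, fst p)\<bar> < \<delta>"
          "\<forall>x. e t (e s x) = e t x" and w: "w \<in> K"
        obtain p where p: "p \<in> J'" "eventually (\<lambda>x. snd p (e t x)) w"
          using ultra_finite[OF K_ultra[OF w] J'(1), of "\<lambda>p x. snd p (e t x)"]
            K_eventually[OF w J'(3)] by blast
        have "\<bar>f (s, filtermap (e s) w) - f (t, fst p)\<bar> < \<delta>"
          using s p filtermap_e_pts[OF w] by (simp add: eventually_filtermap)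
        moreover have "nb t (\<lambda>s. \<forall>w. (s, w) \<in> pts \<longrightarrow>
          eventually (\<lambda>x. snd p (e t x)) w \<longrightarrow> \<bar>f (s, w) - f (t, fst p)\<bar> < \<delta>)"
          using J'(2) p(1) by (auto simp: J_def)
        then have "\<bar>f (t, filtermap (e t) w) - f (t, fst p)\<bar> < \<delta>"
          using p filtermap_e_pts[OF w] by (auto dest!: nb_self simp: eventually_filtermap)
        moreover have "\<delta> + \<delta> = 1 / real (Suc n)"
          unfolding \<delta>_def by (rule field_sum_of_halves)
        ultimately show "\<bar>f (s, filtermap (e s) w) - f (t, filtermap (e t) w)\<bar> < 1 / real (Suc n)"
          by linarith
      qed
    qed
    from nb_all_nat[of t, OF approx]
    show "nb t (\<lambda>s. \<forall>u\<in>K. f (s, filtermap (e s) u) = f (t, filtermap (e t) u))"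
    proof (rule nb_mono, intro ballI)
      fix s u assume *: "\<forall>n. \<forall>w\<in>K. \<bar>f (s, filtermap (e s) w) - f (t, filtermap (e t) w)\<bar> < 1 / real (Suc n)"
        and "u \<in> K"
      show "f (s, filtermap (e s) u) = f (t, filtermap (e t) u)"
      proof (rule ccontr)
        assume "\<not> ?thesis"
        then obtain n where "inverse (real (Suc n)) < \<bar>f (s, filtermap (e s) u) - f (t, filtermap (e t) u)\<bar>"
          using reals_Archimedean[of "\<bar>f (s, filtermap (e s) u) - f (t, filtermap (e t) u)\<bar>"] by auto
        with * \<open>u \<in> K\<close> show False
          by (metis inverse_eq_divide less_asym)
      qed
    qed
  qed simp
qed

lemma compatible_eq: "(t, u) \<in> pts \<Longrightarrow> f (t, filtermap (e t) u) = f (t, u)"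
  by (simp add: pts_def)

end


subsection \<open>Zero-dimensionality and the F-property\<close>

context two_partitions
begin

definition inv_under :: "('i \<Rightarrow> 'i) \<Rightarrow> ('i filter \<Rightarrow> real) \<Rightarrow> bool" where
  "inv_under c g \<longleftrightarrow> (\<forall>u\<in>K. g (filtermap c u) = g u)"

lemma inv_under_e: "(\<And>c. c \<in> {id, a, b} \<Longrightarrow> inv_under c g) \<Longrightarrow> inv_under (e t) g"
  by (cases t) auto

lemma inv_under_id [simp]: "inv_under id g"
  by (simp add: inv_under_def filtermap_ident id_def)

lemma contK_cong: "(\<And>u. u \<in> K \<Longrightarrow> g u = g' u) \<Longrightarrow> contK g \<longleftrightarrow> contK g'"
  unfolding contK_def by simp

text \<open>The limit of \<open>h\<close> along \<open>filtermap c u\<close> is the limit of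
  \<open>h \<circ> c\<close> along \<open>u\<close>, so invariance on \<open>K\<close> amounts to
  vanishing oscillation of a lift at infinity; \<open>inv_under_Lim\<close> is the converse.\<close>

lemma lift_oscillation:
  assumes "\<And>u. u \<in> K \<Longrightarrow> (h \<longlongrightarrow> g u) u" "inv_under c g" "\<And>x. lev (c x) = lev x"
  shows "((\<lambda>x. h x - h (c x)) \<longlongrightarrow> 0) F"
proof (rule tendsto_F_if_K)
  fix u assume u: "u \<in> K"
  have "(h \<longlongrightarrow> g (filtermap c u)) (filtermap c u)"
    using assms(1) K_filtermap[OF u assms(3)] by blast
  then have "((\<lambda>x. h (c x)) \<longlongrightarrow> g u) u"
    using assms(2) u by (simp add: filterlim_filtermap inv_under_def)
  from tendsto_diff[OF assms(1)[OF u] this] show "((\<lambda>x. h x - h (c x)) \<longlongrightarrow> 0) u"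
    by simp
qed

lemma inv_under_Lim:
  assumes "\<And>x. \<bar>h x\<bar> \<le> M" "((\<lambda>x. h x - h (c x)) \<longlongrightarrow> 0) F"
  shows "inv_under c (\<lambda>u. Lim u h)"
  unfolding inv_under_def
proof
  fix u assume u: "u \<in> K"
  have "((\<lambda>x. h x - (h x - h (c x))) \<longlongrightarrow> Lim u h - 0) u"
    by (intro tendsto_diff ultra_bounded_tendsto[OF K_ultra[OF u] assms(1)] tendsto_K[OF u assms(2)])
  then have "(h \<longlongrightarrow> Lim u h) (filtermap c u)"
    by (simp add: filterlim_filtermap)
  then show "Lim (filtermap c u) h = Lim u h"
    by (intro tendsto_Lim ultra_not_bot ultra_filtermap K_ultra[OF u])
qed

lemma pts_eventually:
  assumes "(t, u) \<in> pts"
  shows "eventually (\<lambda>x. B (e t x)) u \<longleftrightarrow> eventually B u"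
proof -
  have "eventually B (filtermap (e t) u) \<longleftrightarrow> eventually B u"
    using assms by (simp add: pts_def)
  then show ?thesis
    by (simp add: eventually_filtermap)
qed

text \<open>Nearby fibres carry literally the same data \<open>D t\<close>, so even an operation
  \<open>\<Psi>\<close> made by arbitrary choice yields a locally constant family, provided its
  results are continuous and keep the invariances. The value 0 off \<open>A\<close> and
  \<open>K\<close> turns agreement on \<open>K\<close> into equality of functions.\<close>

lemma compatible_select:
  fixes \<Psi> :: "('j \<Rightarrow> 'i filter \<Rightarrow> real) \<Rightarrow> 'i filter \<Rightarrow> real"
  assumes "finite A" "\<And>i. i \<in> A \<Longrightarrow> compatible (\<phi> i)"
  defines "D \<equiv> \<lambda>t i u. if i \<in> A \<and> u \<in> K then \<phi> i t u else 0"
  assumes \<Psi>: "\<And>t. contK (\<Psi> (D t))"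
    "\<And>t c. c \<in> {id, a, b} \<Longrightarrow> (\<And>i. i \<in> A \<Longrightarrow> inv_under c (D t i)) \<Longrightarrow> inv_under c (\<Psi> (D t))"
  shows "compatible (\<lambda>t. \<Psi> (D t))"
proof -
  have "nb t (\<lambda>s. \<forall>i\<in>A. \<forall>u\<in>K. \<phi> i s u = \<phi> i t u)" for t
    by (rule nb_ball_finite[OF assms(1)]) (use assms(2) in \<open>auto simp: compatible_def\<close>)
  then have "nb t (\<lambda>s. \<forall>u\<in>K. \<Psi> (D s) u = \<Psi> (D t) u)" for t
  proof (rule nb_mono)
    fix s assume "\<forall>i\<in>A. \<forall>u\<in>K. \<phi> i s u = \<phi> i t u"
    then have "D s = D t" by (auto simp: D_def fun_eq_iff)
    then show "\<forall>u\<in>K. \<Psi> (D s) u = \<Psi> (D t) u" by simp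
  qed
  moreover have "inv_under (e t) (\<Psi> (D t))" for t
  proof (rule \<Psi>(2))
    show "e t \<in> {id, a, b}" by (cases t) auto
    show "inv_under (e t) (D t i)" if "i \<in> A" for i
      using assms(2)[OF that] that K_filtermap[of _ "e t"]
      by (simp add: inv_under_def D_def compatible_def)
  qed
  ultimately show ?thesis
    using \<Psi>(1) unfolding compatible_def inv_under_def by blast
qed

lemma clopen_box:
  assumes "\<And>r. nb r (\<lambda>s. s \<in> V \<longleftrightarrow> r \<in> V)" "\<And>s x. s \<in> V \<Longrightarrow> e t (e s x) = e t x"
  shows "openin plank_space {(s, w). (s, w) \<in> pts \<and> s \<in> V \<and> eventually (\<lambda>x. B (e t x)) w}" (is "openin _ ?W")
    and "closedin plank_space {(s, w). (s, w) \<in> pts \<and> s \<in> V \<and> eventually (\<lambda>x. B (e t x)) w}"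
proof -
  \<comment> \<open>The indicator of the box is compatible, and the box is its preimage both of an
    open and of a closed half-line.\<close>
  define \<phi> where "\<phi> s w = (if s \<in> V \<and> eventually (\<lambda>x. B (e t x)) w then 1 else 0 :: real)" for s w
  have "compatible \<phi>"
    unfolding compatible_def
  proof (intro allI conjI)
    fix s
    show "contK (\<phi> s)"
      unfolding contK_def
    proof (intro ballI allI impI)
      fix u and \<epsilon> :: real assume "u \<in> K" "\<epsilon> > 0"
      show "\<exists>C. eventually C u \<and> (\<forall>w\<in>K. eventually C w \<longrightarrow> \<bar>\<phi> s w - \<phi> s u\<bar> < \<epsilon>)"
      proof (cases "eventually (\<lambda>x. B (e t x)) u")
        case True
        with \<open>\<epsilon> > 0\<close> show ?thesis
          by (intro exI[of _ "\<lambda>x. B (e t x)"]) (simp add: \<phi>_def)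
      next
        case False
        with \<open>\<epsilon> > 0\<close> show ?thesis
          using ultra_not_iff[OF K_ultra] \<open>u \<in> K\<close>
          by (intro exI[of _ "\<lambda>x. \<not> B (e t x)"]) (simp add: \<phi>_def)
      qed
    qed
    show "\<forall>u\<in>K. \<phi> s (filtermap (e s) u) = \<phi> s u"
      using assms(2)[of s] by (cases "s \<in> V") (simp_all add: \<phi>_def eventually_filtermap)
    show "nb s (\<lambda>r. \<forall>u\<in>K. \<phi> r u = \<phi> s u)"
      using assms(1)[of s] by (rule nb_mono) (simp add: \<phi>_def)
  qed
  then have c: "continuous_map plank_space euclideanreal (\<lambda>(s, w). \<phi> s w)"
    by (rule continuous_if_compatible) simp
  have W: "?W = {x \<in> topspace plank_space. (\<lambda>(s, w). \<phi> s w) x \<in> {1/2<..}}"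
    "?W = {x \<in> topspace plank_space. (\<lambda>(s, w). \<phi> s w) x \<in> {1/2..}}"
    by (auto simp: \<phi>_def split: if_splits)
  show "openin plank_space ?W"
    unfolding W(1) by (rule openin_continuous_map_preimage[OF c]) simp
  show "closedin plank_space ?W"
    unfolding W(2) by (rule closedin_continuous_map_preimage[OF c]) simp
qed

lemma t1_space_plank: "t1_space plank_space"
  unfolding t1_space_closedin_singleton
proof
  fix p assume p: "p \<in> topspace plank_space"
  have "openin plank_space (pts - {p})"
    unfolding openin_plank_space
  proof (intro conjI allI impI)
    fix t u assume tu: "(t, u) \<in> pts - {p}"
    then have u: "u \<in> K" "filtermap (e t) u = u"
      by (auto simp: pts_def)
    obtain t' u' where p': "p = (t', u')" by fastforce
    show "\<exists>B. eventually B u \<and> nb t (\<lambda>s. \<forall>w. (s, w) \<in> pts \<longrightarrow>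
        eventually (\<lambda>x. B (e t x)) w \<longrightarrow> (s, w) \<in> pts - {p})"
    proof (cases "t' = t")
      case False
      from nb_neq[OF this] show ?thesis
        by (intro exI[of _ "\<lambda>x. True"]) (auto elim!: nb_mono simp: p')
    next
      case True
      with p' tu have "u \<noteq> u'" by auto
      \<comment> \<open>Distinct filters need to differ in one direction only; in the wrong
        direction the complement of the separating set is used.\<close>
      have "\<not> u' \<le> u \<or> \<not> u \<le> u'"
        using \<open>u \<noteq> u'\<close> by auto
      then obtain B where B: "eventually B u" "\<not> eventually B u'"
      proof
        assume "\<not> u' \<le> u"
        then show thesis using that by (auto simp: le_filter_def)
      next
        assume "\<not> u \<le> u'"
        then obtain B where "eventually B u'" "\<not> eventually B u" by (auto simp: le_filter_def)
        moreover have "ultra u'"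
          using p p' by (auto simp: pts_def K_def)
        ultimately show thesis
          using that[of "\<lambda>x. \<not> B x"] ultra_not_iff K_ultra[OF u(1)] by metis
      qed
      have "\<not> eventually (\<lambda>x. B (e t x)) u'"
        using B(2) p p' True pts_eventually[of t u' B] by simp
      then have "nb t (\<lambda>s. \<forall>w. (s, w) \<in> pts \<longrightarrow>
        eventually (\<lambda>x. B (e t x)) w \<longrightarrow> (s, w) \<in> pts - {p})"
        by (cases t) (auto simp: p' True)
      with B(1) show ?thesis by blast
    qed
  qed blast
  then show "closedin plank_space {p}"
    using p by (simp add: closedin_def)
qed

lemma zero_dimensional_plank: "zero_dimensional_space plank_space"
  unfolding zero_dimensional_space_iff
proof
  show "plank_space dim_le 0"
    unfolding dimension_le_0_neighbourhood_base_of_clopen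
  proof (subst open_neighbourhood_base_of, simp, intro allI impI, elim conjE)
    fix W p assume W: "openin plank_space W" "p \<in> W"
    obtain t u where p: "p = (t, u)" by fastforce
    with W obtain B where B: "eventually B u" "nb t (\<lambda>s. \<forall>w. (s, w) \<in> pts \<longrightarrow>
        eventually (\<lambda>x. B (e t x)) w \<longrightarrow> (s, w) \<in> W)" and "(t, u) \<in> pts"
      unfolding openin_plank_space by blast
    obtain V where V: "t \<in> V" "\<And>r. nb r (\<lambda>s. s \<in> V \<longleftrightarrow> r \<in> V)"
      "\<And>s. s \<in> V \<Longrightarrow> \<forall>w. (s, w) \<in> pts \<longrightarrow> eventually (\<lambda>x. B (e t x)) w \<longrightarrow> (s, w) \<in> W"
      "\<And>s. s \<in> V \<Longrightarrow> s = t \<or> (\<exists>\<alpha> \<gamma>. s = Inner \<alpha> \<gamma>)"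
      using nb_clopen[OF B(2)] by metis
    have "e t (e s x) = e t x" if "s \<in> V" for s x
      using V(4)[OF that] by auto
    note box = clopen_box[OF V(2) this, of B]
    have "eventually (\<lambda>x. B (e t x)) u"
      using B(1) \<open>(t, u) \<in> pts\<close> pts_eventually by blast
    then show "\<exists>U. (closedin plank_space U \<and> openin plank_space U) \<and> p \<in> U \<and> U \<subseteq> W"
      using box V(1,3) \<open>(t, u) \<in> pts\<close> p by (intro exI[of _ "{(s, w). (s, w) \<in> pts \<and> s \<in> V \<and> eventually (\<lambda>x. B (e t x)) w}"]) auto
  qed
qed (rule t1_space_plank)

lemma tychonoff_plank: "tychonoff_space plank_space"
  using zero_dimensional_plank t1_space_plank zero_dimensional_imp_completely_regular_space
  unfolding tychonoff_space_def zero_dimensional_space_iff by blast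

text \<open>The sign of \<open>v\<close> is realised by truncating a large multiple of a lift of \<open>v\<close>. Letting the
  factor grow slowly compared with the oscillation of the lift keeps the invariances of \<open>v\<close>.\<close>

lemma contK_sign:
  assumes "contK v"
  shows "\<exists>k. contK k \<and> (\<forall>u\<in>K. v u = k u * \<bar>v u\<bar>) \<and> (\<forall>c\<in>{id, a, b}. inv_under c v \<longrightarrow> inv_under c k)"
proof -
  obtain h where h: "\<And>u. u \<in> K \<Longrightarrow> (h \<longlongrightarrow> v u) u"
    by (rule contK_lift[OF assms]) blast
  have lev_c: "lev (c x) = lev x" if "c \<in> {id, a, b}" for c x
    using that by (auto simp: lev_a lev_b)
  \<comment> \<open>A factor \<open>k\<close> turns an oscillation below
    \<open>1 / (k + 1)^2\<close> into one of at most \<open>1 / (k + 1)\<close>, which still tends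
    to 0.\<close>
  define P where "P k N \<longleftrightarrow> (\<forall>c\<in>{id, a, b}. inv_under c v \<longrightarrow>
    (\<forall>x. lev x = N \<longrightarrow> \<bar>h x - h (c x)\<bar> < 1 / real (Suc k) ^ 2))" for k N
  have "eventually (\<lambda>N. inv_under c v \<longrightarrow> (\<forall>x. lev x = N \<longrightarrow> \<bar>h x - h (c x)\<bar> < 1 / real (Suc k) ^ 2)) sequentially"
    if "c \<in> {id, a, b}" for c k
  proof (cases "inv_under c v")
    case True
    from lift_oscillation[OF h this lev_c[OF that]]
    have "eventually (\<lambda>x. \<bar>h x - h (c x)\<bar> < 1 / real (Suc k) ^ 2) F"
      by (auto dest!: tendstoD[of _ _ _ "1 / real (Suc k) ^ 2"] simp: dist_real_def)
    then show ?thesis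
      unfolding eventually_F_iff by (auto elim: eventually_mono)
  qed simp
  then have "eventually (P k) sequentially" for k
    unfolding P_def by (intro eventually_ball_finite) auto
  then obtain \<kappa> where \<kappa>: "filterlim \<kappa> at_top sequentially" "eventually (\<lambda>N. P (\<kappa> N) N) sequentially"
    by (rule diagonal_sequence)
  define h' where "h' x = max (-1) (min 1 (real (\<kappa> (lev x)) * h x))" for x
  have bound: "\<bar>h' x\<bar> \<le> 1" for x
    by (auto simp: h'_def)
  have inv: "((\<lambda>x. h' x - h' (c x)) \<longlongrightarrow> 0) F" if c: "c \<in> {id, a, b}" "inv_under c v" for c
  proof (rule Lim_null_comparison)
    show "eventually (\<lambda>x. norm (h' x - h' (c x)) \<le> 1 / real (Suc (\<kappa> (lev x)))) F"
      using eventually_F_lev[OF \<kappa>(2)]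
    proof eventually_elim
      case (elim x)
      let ?k = "\<kappa> (lev x)"
      have "\<bar>h' x - h' (c x)\<bar> \<le> \<bar>real ?k * h x - real ?k * h (c x)\<bar>"
        unfolding h'_def lev_c[OF c(1)] by (auto simp: max_def min_def)
      also have "\<dots> = real ?k * \<bar>h x - h (c x)\<bar>"
        by (simp add: abs_mult flip: right_diff_distrib)
      also have "\<dots> \<le> real (Suc ?k) * (1 / real (Suc ?k) ^ 2)"
        using elim c unfolding P_def by (intro mult_mono) (auto intro: less_imp_le)
      also have "\<dots> = 1 / real (Suc ?k)"
        by (simp add: power2_eq_square)
      finally show ?case by simp
    qed
    have "(\<lambda>n. 1 / real (Suc n)) \<longlonglongrightarrow> 0"
      using LIMSEQ_inverse_real_of_nat by (simp add: inverse_eq_divide)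
    then show "((\<lambda>x. 1 / real (Suc (\<kappa> (lev x)))) \<longlongrightarrow> 0) F"
      by (rule filterlim_compose[OF _ filterlim_F_lev[OF \<kappa>(1)]])
  qed
  have "v u = Lim u h' * \<bar>v u\<bar>" if u: "u \<in> K" for u
  proof (cases "v u = 0")
    case False
    have "filterlim (\<lambda>x. real (\<kappa> (lev x))) at_top u"
      by (rule filterlim_compose[OF filterlim_real_sequentially])
        (use filterlim_F_lev[OF \<kappa>(1)] u in \<open>auto simp: K_def intro: filterlim_mono\<close>)
    \<comment> \<open>Along \<open>u\<close> the lift eventually has at least half the absolute
      value of \<open>v u\<close>, so this factor pushes it past 1 or -1 and the truncation is
      exactly the sign.\<close>
    then have big: "eventually (\<lambda>x. real (\<kappa> (lev x)) \<ge> 2 / \<bar>v u\<bar>) u"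
      by (simp add: filterlim_at_top)
    have "eventually (\<lambda>x. \<bar>h x - v u\<bar> < \<bar>v u\<bar> / 2) u"
      using tendstoD[OF h[OF u], of "\<bar>v u\<bar> / 2"] False by (simp add: dist_real_def)
    with big have "eventually (\<lambda>x. h' x = sgn (v u)) u"
    proof eventually_elim
      case (elim x)
      let ?k = "real (\<kappa> (lev x))"
      have k: "?k * (\<bar>v u\<bar> / 2) \<ge> 1"
        using elim(1) False by (simp add: field_simps)
      show ?case
      proof (cases "v u > 0")
        case True
        then have "h x \<ge> \<bar>v u\<bar> / 2" using elim(2) by linarith
        then have "?k * h x \<ge> ?k * (\<bar>v u\<bar> / 2)" by (intro mult_left_mono) auto
        with k have "?k * h x \<ge> 1" by linarith
        with True show ?thesis by (simp add: h'_def)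
      next
        case neg: False
        then have "h x \<le> - (\<bar>v u\<bar> / 2)" using elim(2) by linarith
        then have "?k * h x \<le> ?k * (- (\<bar>v u\<bar> / 2))" by (intro mult_left_mono) auto
        with k have "?k * h x \<le> - 1" by linarith
        with neg False show ?thesis by (simp add: h'_def)
      qed
    qed
    then have "(h' \<longlongrightarrow> sgn (v u)) u"
      by (rule tendsto_eventually)
    then have "Lim u h' = sgn (v u)"
      by (intro tendsto_Lim ultra_not_bot K_ultra u)
    then show ?thesis by (simp add: sgn_mult_abs)
  qed simp
  then show ?thesis
    using contK_Lim[of h', OF bound] inv_under_Lim[of h', OF bound] inv
    by (intro exI[of _ "\<lambda>u. Lim u h'"]) blast
qed

lemma F_space_plank: "F_space plank_space"
  unfolding F_space_def
proof (intro conjI allI impI)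
  fix f assume f: "continuous_map plank_space euclideanreal f"
  define \<phi> where "\<phi> t u = f (t, filtermap (e t) u)" for t u
  have \<phi>: "compatible \<phi>"
    unfolding \<phi>_def by (rule compatible_if_continuous[OF f])
  \<comment> \<open>One choice that depends only on the function \<open>v\<close>, so fibres with
    equal data receive equal sign functions.\<close>
  define \<Psi> where "\<Psi> v = (SOME k. contK k \<and> (\<forall>u\<in>K. v u = k u * \<bar>v u\<bar>) \<and>
    (\<forall>c\<in>{id, a, b}. inv_under c v \<longrightarrow> inv_under c k))" for v
  define D where "D t = (\<lambda>u. if u \<in> K then \<phi> t u else 0)" for t
  have D: "contK (D t)" for t
    using \<phi> contK_cong[of "D t" "\<phi> t"] by (simp add: D_def compatible_def)
  have \<Psi>: "contK (\<Psi> (D t))" "\<forall>u\<in>K. D t u = \<Psi> (D t) u * \<bar>D t u\<bar>"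
    "\<forall>c\<in>{id, a, b}. inv_under c (D t) \<longrightarrow> inv_under c (\<Psi> (D t))" for t
    using someI_ex[OF contK_sign[OF D[of t]]] unfolding \<Psi>_def by blast+
  \<comment> \<open>The index set \<open>{()}\<close> presents the single family
    \<open>\<phi>\<close> in the form that \<open>compatible_select\<close> expects.\<close>
  have "compatible (\<lambda>t. (\<lambda>d. \<Psi> (d ())) (\<lambda>i u. if i \<in> {()} \<and> u \<in> K then (\<lambda>_. \<phi>) i t u else 0))"
    by (rule compatible_select) (use \<phi> \<Psi>(1,3) in \<open>auto simp: D_def\<close>)
  then have "compatible (\<lambda>t. \<Psi> (D t))"
    by (simp add: D_def)
  then have "continuous_map plank_space euclideanreal (\<lambda>(t, u). \<Psi> (D t) u)"
    by (rule continuous_if_compatible) simp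
  moreover have "f p = (case p of (t, u) \<Rightarrow> \<Psi> (D t) u) * \<bar>f p\<bar>" if "p \<in> topspace plank_space" for p
  proof -
    obtain t u where p: "p = (t, u)" by fastforce
    with that have "u \<in> K" "f p = D t u"
      by (auto simp: pts_def D_def \<phi>_def)
    with \<Psi>(2)[of t] p show ?thesis by simp
  qed
  ultimately show "\<exists>k. continuous_map plank_space euclideanreal k \<and> (\<forall>x\<in>topspace plank_space. f x = k x * \<bar>f x\<bar>)"
    by blast
qed (rule tychonoff_plank)

end


subsection \<open>Covering dimension\<close>

lemma finite_argmax:
  fixes f :: "'a \<Rightarrow> real"
  assumes "finite A" "A \<noteq> {}"
  shows "\<exists>i\<in>A. \<forall>j\<in>A. f j \<le> f i"
proof -
  have "Max (f ` A) \<in> f ` A"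
    using assms by (intro Max_in) auto
  then obtain i where "i \<in> A" "f i = Max (f ` A)" by auto
  then show ?thesis
    using assms by (intro bexI[of _ i]) auto
qed

lemma cozero_functions:
  assumes "finite_cozero_cover X \<U>"
  shows "\<exists>g. \<forall>U\<in>\<U>. continuous_map X euclideanreal (g U) \<and> U = {x \<in> topspace X. g U x \<noteq> 0}"
  by (rule bchoice) (use assms in \<open>auto simp: finite_cozero_cover_def cozero_set_in_def\<close>)

context two_partitions
begin

section \<open>Upper bound: refinements in \<open>d + 1\<close> colours\<close>

definition slow_at :: "nat \<Rightarrow> real \<Rightarrow> ('i \<Rightarrow> real) \<Rightarrow> bool" where
  "slow_at N \<delta> g \<longleftrightarrow> (\<forall>x. lev x = N \<longrightarrow> \<bar>g x - g (a x)\<bar> \<le> \<delta> \<and> \<bar>g x - g (b x)\<bar> \<le> \<delta>)"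

lemma lift_slow_at:
  assumes "\<And>u. u \<in> K \<Longrightarrow> (h \<longlongrightarrow> g u) u" "inv_under a g" "inv_under b g" "\<delta> > 0"
  shows "eventually (\<lambda>N. slow_at N \<delta> h) sequentially"
proof -
  have "eventually (\<lambda>x. \<bar>h x - h (a x)\<bar> < \<delta>) F" "eventually (\<lambda>x. \<bar>h x - h (b x)\<bar> < \<delta>) F"
    using tendstoD[OF lift_oscillation[OF assms(1,2) lev_a] assms(4)]
      tendstoD[OF lift_oscillation[OF assms(1,3) lev_b] assms(4)] by (simp_all add: dist_real_def)
  then have "eventually (\<lambda>x. \<bar>h x - h (a x)\<bar> \<le> \<delta> \<and> \<bar>h x - h (b x)\<bar> \<le> \<delta>) F"
    by eventually_elim simp
  then show ?thesis
    by (simp add: eventually_F_iff slow_at_def)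
qed

definition argmax :: "'j set \<Rightarrow> ('j \<Rightarrow> 'i \<Rightarrow> real) \<Rightarrow> 'i \<Rightarrow> 'j" where
  "argmax A w y = (SOME i. i \<in> A \<and> (\<forall>j\<in>A. \<bar>w j y\<bar> \<le> \<bar>w i y\<bar>))"

lemma argmax:
  assumes "finite A" "A \<noteq> {}"
  shows argmax_in: "argmax A w y \<in> A" and argmax_ge: "j \<in> A \<Longrightarrow> \<bar>w j y\<bar> \<le> \<bar>w (argmax A w y) y\<bar>"
proof -
  have "\<exists>i. i \<in> A \<and> (\<forall>j\<in>A. \<bar>w j y\<bar> \<le> \<bar>w i y\<bar>)"
    using finite_argmax[OF assms, of "\<lambda>i. \<bar>w i y\<bar>"] by blast
  from someI_ex[OF this] show "argmax A w y \<in> A" "j \<in> A \<Longrightarrow> \<bar>w j y\<bar> \<le> \<bar>w (argmax A w y) y\<bar>"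
    unfolding argmax_def by blast+
qed

text \<open>Where \<open>i0\<close> is selected, its function dominates that of \<open>i1\<close>,
  and this survives the limit. The points \<open>r x\<close> may differ from \<open>x\<close> as
  long as they lead to the limits \<open>v i\<close>.\<close>

lemma argmax_limit_nonzero:
  assumes "finite A" "u \<in> K" "\<And>i. i \<in> A \<Longrightarrow> ((\<lambda>x. w i (r x)) \<longlongrightarrow> v i) u"
    and "eventually (\<lambda>x. argmax A w (r x) = i0) u" "i1 \<in> A" "v i1 \<noteq> 0"
  shows "v i0 \<noteq> 0"
proof -
  have ne: "A \<noteq> {}" using assms by auto
  obtain x where "argmax A w (r x) = i0"
    using eventually_happens[OF assms(4)] ultra_not_bot[OF K_ultra[OF assms(2)]] by auto
  then have i0: "i0 \<in> A"
    using argmax_in[OF assms(1) ne] by auto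
  have "eventually (\<lambda>x. \<bar>w i1 (r x)\<bar> \<le> \<bar>w i0 (r x)\<bar>) u"
    using assms(4) by eventually_elim (use argmax_ge[OF assms(1) ne assms(5)] in metis)
  then have "\<bar>v i1\<bar> \<le> \<bar>v i0\<bar>"
    by (intro tendsto_le[OF _ tendsto_rabs[OF assms(3)[OF i0]] tendsto_rabs[OF assms(3)[OF assms(5)]]]
        ultra_not_bot K_ultra assms)
  with assms(6) show ?thesis by auto
qed

text \<open>At each point the bump of colour \<open>c\<close> goes wholly to the index that is
  largest at \<open>rep c x\<close>. Along an ultrafilter this index is eventually constant, so at
  most one function of each colour is nonzero there.\<close>

lemma refinement_from_cells:
  fixes Hc :: "nat \<Rightarrow> 'i \<Rightarrow> real" and rep :: "nat \<Rightarrow> 'i \<Rightarrow> 'i"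
  assumes "finite A" "A \<noteq> {}" and Q: "\<forall>u\<in>K. \<exists>i\<in>A. v i u \<noteq> 0"
    and H01: "\<forall>c x. 0 \<le> Hc c x \<and> Hc c x \<le> 1" and Hcov: "\<forall>x. \<exists>c\<le>d. Hc c x \<ge> 1 / 2"
    and rep: "\<forall>c. \<forall>u\<in>K. \<forall>i\<in>A. ((\<lambda>x. w i (rep c x)) \<longlongrightarrow> v i u) u"
  defines "h \<equiv> \<lambda>c i u. Lim u (\<lambda>x. if argmax A w (rep c x) = i then Hc c x else 0)"
  shows "contK (h c i)"
    and "((\<lambda>x. (if argmax A w (rep c x) = i then Hc c x else 0) -
       (if argmax A w (rep c (k x)) = i then Hc c (k x) else 0)) \<longlongrightarrow> 0) F \<Longrightarrow> inv_under k (h c i)"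
    and "u \<in> K \<Longrightarrow> \<exists>c\<le>d. \<exists>i\<in>A. h c i u \<noteq> 0"
    and "u \<in> K \<Longrightarrow> h c i u \<noteq> 0 \<Longrightarrow> v i u \<noteq> 0 \<and> (\<forall>j. h c j u \<noteq> 0 \<longrightarrow> j = i)"
proof -
  let ?h = "\<lambda>c i x. if argmax A w (rep c x) = i then Hc c x else 0"
  have bound: "\<bar>?h c i x\<bar> \<le> 1" for c i x
    using H01 by auto
  show "contK (h c i)" for c i
    unfolding h_def by (rule contK_Lim) (rule bound)
  show "((\<lambda>x. ?h c i x - ?h c i (k x)) \<longlongrightarrow> 0) F \<Longrightarrow> inv_under k (h c i)" for c i k
    unfolding h_def by (rule inv_under_Lim) (rule bound)
  have in_A: "eventually (\<lambda>x. argmax A w (rep c x) \<in> A) u" for c u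
    using argmax_in[OF assms(1,2)] by simp
  have lim: "(?h c i \<longlongrightarrow> h c i u) u" if "u \<in> K" for u c i
    unfolding h_def by (rule ultra_bounded_tendsto[OF K_ultra[OF that] bound])
  show "\<exists>c\<le>d. \<exists>i\<in>A. h c i u \<noteq> 0" if u: "u \<in> K" for u
  proof -
    \<comment> \<open>The lower bound 1/2 for some colour, unlike mere positivity, survives the
      limit along \<open>u\<close>.\<close>
    have "eventually (\<lambda>x. \<exists>c\<in>{..d}. Hc c x \<ge> 1 / 2) u"
      using Hcov by (auto intro!: always_eventually)
    then obtain c where c: "c \<le> d" "eventually (\<lambda>x. Hc c x \<ge> 1 / 2) u"
      using ultra_finite[OF K_ultra[OF u], of "{..d}" "\<lambda>c x. Hc c x \<ge> 1 / 2"] by auto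
    obtain i where i: "i \<in> A" "eventually (\<lambda>x. argmax A w (rep c x) = i) u"
      using ultra_finite_range[OF K_ultra[OF u] assms(1) in_A] by blast
    have "eventually (\<lambda>x. ?h c i x \<ge> 1 / 2) u"
      using c(2) i(2) by eventually_elim simp
    then have "h c i u \<ge> 1 / 2"
      by (rule tendsto_lowerbound[OF lim[OF u] _ ultra_not_bot[OF K_ultra[OF u]]])
    with c i show ?thesis by force
  qed
  show "v i u \<noteq> 0 \<and> (\<forall>j. h c j u \<noteq> 0 \<longrightarrow> j = i)" if u: "u \<in> K" and nz: "h c i u \<noteq> 0" for u c i
  proof -
    have sel: "eventually (\<lambda>x. argmax A w (rep c x) = j) u" if "h c j u \<noteq> 0" for j
    proof (rule ccontr)
      assume "\<not> ?thesis"
      then have "eventually (\<lambda>x. argmax A w (rep c x) \<noteq> j) u"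
        using ultra_not_iff[OF K_ultra[OF u]] by blast
      then have "eventually (\<lambda>x. ?h c j x = 0) u"
        by eventually_elim simp
      then have "h c j u = 0"
        using tendsto_unique[OF ultra_not_bot[OF K_ultra[OF u]] lim[OF u] tendsto_eventually] by blast
      with that show False by simp
    qed
    obtain i1 where i1: "i1 \<in> A" "v i1 u \<noteq> 0"
      using Q u by blast
    have "v i u \<noteq> 0"
      by (rule argmax_limit_nonzero[OF assms(1) u _ sel[OF nz], of "\<lambda>i. v i u" i1])
        (use rep u i1 in auto)
    moreover have "j = i" if "h c j u \<noteq> 0" for j
    proof -
      have "eventually (\<lambda>x. j = i) u"
        using sel[OF that] sel[OF nz] by eventually_elim simp
      then show ?thesis
        using ultra_not_bot[OF K_ultra[OF u]] by simp
    qed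
    ultimately show ?thesis by blast
  qed
qed

text \<open>\<open>H L c\<close> are bumps of colour \<open>c\<close> and slope \<open>1 / L\<close>, supported on pieces of bounded size (named
  by \<open>\<pi> L c\<close>) that are separated by the zeros of \<open>H L c\<close>.\<close>

definition cells :: "nat \<Rightarrow> (nat \<Rightarrow> nat \<Rightarrow> 'i \<Rightarrow> real) \<Rightarrow> (nat \<Rightarrow> nat \<Rightarrow> 'i \<Rightarrow> 'p) \<Rightarrow> (nat \<Rightarrow> real) \<Rightarrow> bool" where
  "cells d H \<pi> R \<longleftrightarrow> (\<forall>L\<ge>1.
    (\<forall>c x. 0 \<le> H L c x \<and> H L c x \<le> 1) \<and>
    (\<forall>x. \<exists>c\<le>d. H L c x \<ge> 1 / 2) \<and>
    (\<forall>k\<in>{a, b}. \<forall>c x. \<bar>H L c x - H L c (k x)\<bar> \<le> 1 / real L \<and>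
      (\<pi> L c x \<noteq> \<pi> L c (k x) \<longrightarrow> H L c x \<le> 1 / real L \<and> H L c (k x) \<le> 1 / real L)) \<and>
    (\<forall>c x y g \<delta>. lev x = lev y \<longrightarrow> \<pi> L c x = \<pi> L c y \<longrightarrow> 0 \<le> \<delta> \<longrightarrow> slow_at (lev x) \<delta> g \<longrightarrow>
      \<bar>g x - g y\<bar> \<le> R L * \<delta>))"

text \<open>The cozero sets of one colour are pairwise disjoint, so the number of colours bounds the
  order of the refinement. Only invariances shared by all \<open>v i\<close> are inherited, which is
  what \<open>compatible_select\<close> asks for.\<close>

definition coloured_refinements ::
  "nat \<Rightarrow> 'j set \<Rightarrow> ('j \<Rightarrow> 'i filter \<Rightarrow> real) \<Rightarrow> (nat \<Rightarrow> 'j \<Rightarrow> 'i filter \<Rightarrow> real) set" where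
  "coloured_refinements d A v = {h.
    (\<forall>c i. contK (h c i) \<and> (\<forall>k\<in>{id, a, b}. (\<forall>i\<in>A. inv_under k (v i)) \<longrightarrow> inv_under k (h c i))) \<and>
    (\<forall>u\<in>K. (\<exists>c\<le>d. \<exists>i\<in>A. h c i u \<noteq> 0) \<and>
      (\<forall>c i. h c i u \<noteq> 0 \<longrightarrow> v i u \<noteq> 0 \<and> (\<forall>j. h c j u \<noteq> 0 \<longrightarrow> j = i)))}"

text \<open>If not all \<open>v i\<close> are invariant under both partitions, a clopen partition suffices. Otherwise
  each piece is given to the index that is largest at a representative of the piece, and the
  scale \<open>L\<close> grows slowly with the level.\<close>

lemma contK_refinement:
  assumes cells: "cells d H \<pi> R" and A: "finite A"
    and v: "\<And>i. i \<in> A \<Longrightarrow> contK (v i)" and cover: "\<And>u. u \<in> K \<Longrightarrow> \<exists>i\<in>A. v i u \<noteq> 0"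
  shows "\<exists>h. h \<in> coloured_refinements d A v"
proof (cases "A = {}")
  case True
  with cover have "K = {}" by blast
  then show ?thesis
    by (intro exI[of _ "\<lambda>c i u. 0"]) (auto simp: coloured_refinements_def contK_def inv_under_def)
next
  case ne: False
  have "\<forall>i\<in>A. \<exists>w. \<forall>u\<in>K. (w \<longlongrightarrow> v i u) u"
    using contK_lift[OF v] by metis
  then obtain w where w: "\<And>i u. i \<in> A \<Longrightarrow> u \<in> K \<Longrightarrow> (w i \<longlongrightarrow> v i u) u"
    by metis
  have cover': "\<forall>u\<in>K. \<exists>i\<in>A. v i u \<noteq> 0"
    using cover by blast
  let ?P = "\<lambda>k. \<forall>i\<in>A. inv_under k (v i)"
  show ?thesis
  proof (cases "?P a \<and> ?P b")
    case False
    \<comment> \<open>At most one of the two partitions has to be respected here. Its representative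
      map, or \<open>id\<close> if there is none, decides the index, and colour 0 alone
      covers.\<close>
    define k0 where "k0 = (if ?P a then a else if ?P b then b else id)"
    have k0: "k0 \<in> {id, a, b}" "?P k0"
      by (auto simp: k0_def)
    have lev_k0: "lev (k0 x) = lev x" and k0_idem: "k0 (k0 x) = k0 x" for x
      using k0(1) lev_a lev_b a_idem b_idem by auto
    define Hc where "Hc c x = (if c = 0 then 1 else 0 :: real)" for c :: nat and x :: 'i
    let ?h = "\<lambda>c i x. if argmax A w (k0 x) = i then Hc c x else 0"
    have "((\<lambda>x. w i (k0 x)) \<longlongrightarrow> v i u) u" if "u \<in> K" "i \<in> A" for i u
    proof -
      have "(w i \<longlongrightarrow> v i (filtermap k0 u)) (filtermap k0 u)"
        by (rule w[OF that(2) K_filtermap[OF that(1) lev_k0]])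
      then show ?thesis
        using k0(2) that by (simp add: filterlim_filtermap inv_under_def)
    qed
    then have rep: "\<forall>c. \<forall>u\<in>K. \<forall>i\<in>A. ((\<lambda>x. w i ((\<lambda>_. k0) c x)) \<longlongrightarrow> v i u) u"
      by simp
    have H: "\<forall>c x. 0 \<le> Hc c x \<and> Hc c x \<le> 1" "\<forall>x. \<exists>c\<le>d. Hc c x \<ge> 1 / 2"
      by (auto simp: Hc_def)
    have inv: "((\<lambda>x. ?h c i x - ?h c i (k x)) \<longlongrightarrow> 0) F" if "k \<in> {id, a, b}" "?P k" for k c i
    proof -
      have "k = id \<or> k = k0"
        using that False by (auto simp: k0_def)
      then have "(\<lambda>x. ?h c i x - ?h c i (k x)) = (\<lambda>x. 0)"
        by (auto simp: k0_idem Hc_def fun_eq_iff)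
      then show ?thesis by simp
    qed
    show ?thesis
      unfolding coloured_refinements_def mem_Collect_eq
    proof (intro exI[of _ "\<lambda>c i u. Lim u (?h c i)"] conjI allI ballI impI)
      note R = refinement_from_cells[where v = v and w = w and Hc = Hc and rep = "\<lambda>_. k0" and d = d, OF A ne cover' H rep]
      show "contK (\<lambda>u. Lim u (?h c i))" for c i
        by (rule R(1))
      show "inv_under k (\<lambda>u. Lim u (?h c i))" if "k \<in> {id, a, b}" "?P k" for k c i
        by (rule R(2)[OF inv[OF that]])
      fix u assume u: "u \<in> K"
      show "\<exists>c\<le>d. \<exists>i\<in>A. Lim u (?h c i) \<noteq> 0"
        by (rule R(3)[OF u])
      show "v i u \<noteq> 0" if "Lim u (?h c i) \<noteq> 0" for c i
        using R(4)[OF u that] by blast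
      show "j = i" if "Lim u (?h c i) \<noteq> 0" "Lim u (?h c j) \<noteq> 0" for c i j
        using R(4)[OF u that(1)] that(2) by blast
    qed
  next
    case True
    \<comment> \<open>On a piece at scale \<open>k + 1\<close> the lifts vary by at most
      \<open>R (k + 1)\<close> times this constant, hence by at most \<open>1 / (k + 1)\<close>; the
      summand 1 keeps the denominator positive.\<close>
    define \<delta> where "\<delta> k = 1 / (real (Suc k) * (\<bar>R (Suc k)\<bar> + 1))" for k
    have \<delta>: "\<delta> k > 0" "R (Suc k) * \<delta> k \<le> 1 / real (Suc k)" for k
    proof -
      show "\<delta> k > 0" by (simp add: \<delta>_def add_nonneg_pos)
      then have "R (Suc k) * \<delta> k \<le> (\<bar>R (Suc k)\<bar> + 1) * \<delta> k"
        by (intro mult_right_mono) auto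
      also have "\<dots> = 1 / real (Suc k)"
        by (simp add: \<delta>_def)
      finally show "R (Suc k) * \<delta> k \<le> 1 / real (Suc k)" .
    qed
    define P where "P k N \<longleftrightarrow> (\<forall>i\<in>A. slow_at N (\<delta> k) (w i))" for k N
    have "eventually (P k) sequentially" for k
      unfolding P_def using A True w \<delta>(1)
      by (intro eventually_ball_finite ballI lift_slow_at) auto
    then obtain \<kappa> where \<kappa>: "filterlim \<kappa> at_top sequentially" "eventually (\<lambda>N. P (\<kappa> N) N) sequentially"
      by (rule diagonal_sequence)
    define L where "L x = Suc (\<kappa> (lev x))" for x
    have "1 \<le> L x" for x by (simp add: L_def)
    note cell = cells[unfolded cells_def, THEN spec, THEN mp, OF this]
    note cell_bounds = cell[THEN conjunct1, rule_format]
      and cell_cover = cell[THEN conjunct2, THEN conjunct1, rule_format]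
      and cell_step = cell[THEN conjunct2, THEN conjunct2, THEN conjunct1, rule_format]
      and cell_diam = cell[THEN conjunct2, THEN conjunct2, THEN conjunct2, rule_format]
    have L_lim: "((\<lambda>x. 1 / real (L x)) \<longlongrightarrow> 0) F"
    proof -
      have "(\<lambda>n. 1 / real (Suc n)) \<longlonglongrightarrow> 0"
        using LIMSEQ_inverse_real_of_nat by (simp add: inverse_eq_divide)
      then show ?thesis
        unfolding L_def by (rule filterlim_compose[OF _ filterlim_F_lev[OF \<kappa>(1)]])
    qed
    define Hc where "Hc c x = H (L x) c x" for c x
    \<comment> \<open>The representative depends only on the level and the name of the piece, so
      neighbours in one piece select the same index.\<close>
    define rep where "rep c x = (SOME y. lev y = lev x \<and> \<pi> (L x) c y = \<pi> (L x) c x)" for c x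
    have rep: "lev (rep c x) = lev x" "\<pi> (L x) c (rep c x) = \<pi> (L x) c x" for c x
      using someI[of "\<lambda>y. lev y = lev x \<and> \<pi> (L x) c y = \<pi> (L x) c x" x] by (auto simp: rep_def)
    let ?h = "\<lambda>c i x. if argmax A w (rep c x) = i then Hc c x else 0"
    have "((\<lambda>x. w i (rep c x)) \<longlongrightarrow> v i u) u" if u: "u \<in> K" and i: "i \<in> A" for i u c
    proof -
      have "((\<lambda>x. w i x - w i (rep c x)) \<longlongrightarrow> 0) F"
      proof (rule Lim_null_comparison[OF _ L_lim])
        show "eventually (\<lambda>x. norm (w i x - w i (rep c x)) \<le> 1 / real (L x)) F"
          using eventually_F_lev[OF \<kappa>(2)]
        proof eventually_elim
          case (elim x)
          then have "slow_at (lev x) (\<delta> (\<kappa> (lev x))) (w i)"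
            using i by (simp add: P_def)
          then have "\<bar>w i x - w i (rep c x)\<bar> \<le> R (L x) * \<delta> (\<kappa> (lev x))"
            by (intro cell_diam[where c = c]) (use rep \<delta>(1) in \<open>auto intro: less_imp_le\<close>)
          also have "\<dots> \<le> 1 / real (L x)"
            using \<delta>(2) by (simp add: L_def)
          finally show ?case by simp
        qed
      qed
      from tendsto_diff[OF w[OF i u] tendsto_K[OF u this]] show ?thesis
        by simp
    qed
    then have rep_lim: "\<forall>c. \<forall>u\<in>K. \<forall>i\<in>A. ((\<lambda>x. w i (rep c x)) \<longlongrightarrow> v i u) u"
      by blast
    have H: "\<forall>c x. 0 \<le> Hc c x \<and> Hc c x \<le> 1" "\<forall>x. \<exists>c\<le>d. Hc c x \<ge> 1 / 2"
      using cell_bounds cell_cover by (auto simp: Hc_def)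
    have inv: "((\<lambda>x. ?h c i x - ?h c i (k x)) \<longlongrightarrow> 0) F" if "k \<in> {id, a, b}" for k c i
    proof (cases "k = id")
      case False
      with that have k: "k \<in> {a, b}" by auto
      then have Lk: "L (k x) = L x" and lev_k: "lev (k x) = lev x" for x
        by (auto simp: L_def lev_a lev_b)
      \<comment> \<open>Within a piece only the bump changes. Across pieces both bumps are at most
        \<open>1 / L\<close>, so a change of the selected index does no harm.\<close>
      have "norm (?h c i x - ?h c i (k x)) \<le> 1 / real (L x)" for x
      proof -
        have 1: "\<bar>Hc c x - Hc c (k x)\<bar> \<le> 1 / real (L x)"
          "\<pi> (L x) c x \<noteq> \<pi> (L x) c (k x) \<Longrightarrow> Hc c x \<le> 1 / real (L x) \<and> Hc c (k x) \<le> 1 / real (L x)"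
          using cell_step[OF k] unfolding Hc_def Lk by blast+
        show ?thesis
        proof (cases "\<pi> (L x) c x = \<pi> (L x) c (k x)")
          case True
          then have "rep c (k x) = rep c x"
            unfolding rep_def Lk lev_k by simp
          with 1(1) show ?thesis by simp
        next
          case False
          with 1(2) H(1)[rule_format, of c x] H(1)[rule_format, of c "k x"] show ?thesis
            by (auto simp: abs_le_iff)
        qed
      qed
      then show ?thesis
        by (intro Lim_null_comparison[OF _ L_lim] always_eventually allI)
    next
      case True
      show ?thesis
        unfolding True id_apply by simp
    qed
    show ?thesis
      unfolding coloured_refinements_def mem_Collect_eq
    proof (intro exI[of _ "\<lambda>c i u. Lim u (?h c i)"] conjI allI ballI impI)
      note R = refinement_from_cells[where v = v and w = w and Hc = Hc and rep = rep and d = d, OF A ne cover' H rep_lim]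
      show "contK (\<lambda>u. Lim u (?h c i))" for c i
        by (rule R(1))
      show "inv_under k (\<lambda>u. Lim u (?h c i))" if "k \<in> {id, a, b}" for k c i
        by (rule R(2)[OF inv[OF that]])
      fix u assume u: "u \<in> K"
      show "\<exists>c\<le>d. \<exists>i\<in>A. Lim u (?h c i) \<noteq> 0"
        by (rule R(3)[OF u])
      show "v i u \<noteq> 0" if "Lim u (?h c i) \<noteq> 0" for c i
        using R(4)[OF u that] by blast
      show "j = i" if "Lim u (?h c i) \<noteq> 0" "Lim u (?h c j) \<noteq> 0" for c i j
        using R(4)[OF u that(1)] that(2) by blast
    qed
  qed
qed

text \<open>The refinements over all fibres come from one choice \<open>\<Psi>\<close> and so fit
  together to cozero sets of the total space, indexed by a colour and a member of the cover; a point
  lies in at most one of each colour.\<close>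

theorem covering_dim_le_plank:
  assumes cells: "cells d H \<pi> R"
  shows "covering_dim_le plank_space d"
  unfolding covering_dim_le_def
proof (intro allI impI)
  fix \<U> assume \<U>: "finite_cozero_cover plank_space \<U>"
  then have fin: "finite \<U>" by (simp add: finite_cozero_cover_def)
  obtain g where g: "\<And>U. U \<in> \<U> \<Longrightarrow> continuous_map plank_space euclideanreal (g U)"
    "\<And>U. U \<in> \<U> \<Longrightarrow> U = {x \<in> topspace plank_space. g U x \<noteq> 0}"
    using cozero_functions[OF \<U>] by blast
  define \<phi> where "\<phi> U t u = g U (t, filtermap (e t) u)" for U t u
  have \<phi>: "compatible (\<phi> U)" if "U \<in> \<U>" for U
    unfolding \<phi>_def by (rule compatible_if_continuous[OF g(1)[OF that]])
  define D where "D t = (\<lambda>U u. if U \<in> \<U> \<and> u \<in> K then \<phi> U t u else 0)" for t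
  have D_cont: "contK (D t U)" if "U \<in> \<U>" for t U
    using \<phi>[OF that] that contK_cong[of "D t U" "\<phi> U t"] by (simp add: D_def compatible_def)
  have D_cover: "\<exists>U\<in>\<U>. D t U u \<noteq> 0" if "u \<in> K" for t u
  proof -
    have "(t, filtermap (e t) u) \<in> \<Union>\<U>"
      using \<U> filtermap_e_pts[OF that] by (simp add: finite_cozero_cover_def)
    then obtain U where "U \<in> \<U>" "(t, filtermap (e t) u) \<in> U" by blast
    then show ?thesis
      using g(2)[of U] that by (auto simp: D_def \<phi>_def)
  qed
  define \<Psi> where "\<Psi> v = (SOME h. h \<in> coloured_refinements d \<U> v)" for v
  have "\<Psi> (D t) \<in> coloured_refinements d \<U> (D t)" for t
    unfolding \<Psi>_def
    by (rule someI_ex[of "\<lambda>h. h \<in> coloured_refinements d \<U> (D t)"])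
      (rule contK_refinement[OF cells fin D_cont D_cover])
  note \<Psi> = this[unfolded coloured_refinements_def mem_Collect_eq]
  define V where "V c U = {(t, u). (t, u) \<in> pts \<and> \<Psi> (D t) c U u \<noteq> 0}" for c U
  have cozero: "cozero_set_in plank_space (V c U)" for c U
  proof -
    have "contK (\<Psi> (D t) c U)" for t
      using \<Psi>[of t] by blast
    moreover have "inv_under k (\<Psi> (D t) c U)" if "k \<in> {id, a, b}" "\<And>i. i \<in> \<U> \<Longrightarrow> inv_under k (D t i)" for k t
      using \<Psi>[of t] that by blast
    ultimately have "compatible (\<lambda>t. \<Psi> (D t) c U)"
      by (intro compatible_select[where A = \<U> and \<phi> = \<phi> and \<Psi> = "\<lambda>v. \<Psi> v c U", folded D_def] fin \<phi>)
        (simp_all add: D_def)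
    then have "continuous_map plank_space euclideanreal (\<lambda>(t, u). \<Psi> (D t) c U u)"
      by (rule continuous_if_compatible) simp
    then show ?thesis
      unfolding cozero_set_in_def
      by (intro exI[of _ "\<lambda>(t, u). \<Psi> (D t) c U u"]) (auto simp: V_def)
  qed
  let ?\<V> = "(\<lambda>(c, U). V c U) ` ({..d} \<times> \<U>)"
  have "finite_cozero_cover plank_space ?\<V>"
    unfolding finite_cozero_cover_def
  proof (intro conjI)
    show "finite ?\<V>" using fin by simp
    show "\<forall>W\<in>?\<V>. cozero_set_in plank_space W" using cozero by auto
    show "\<Union>?\<V> = topspace plank_space"
    proof (rule subset_antisym)
      show "topspace plank_space \<subseteq> \<Union>?\<V>"
      proof
        fix p assume p: "p \<in> topspace plank_space"
        obtain t u where tu: "p = (t, u)" by fastforce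
        with p have "u \<in> K" by (simp add: pts_def)
        with \<Psi>[of t] obtain c U where "c \<le> d" "U \<in> \<U>" "\<Psi> (D t) c U u \<noteq> 0" by blast
        then show "p \<in> \<Union>?\<V>"
          using p tu by (intro UN_I[of "(c, U)"]) (auto simp: V_def)
      qed
    qed (auto simp: V_def)
  qed
  moreover have "\<forall>W\<in>?\<V>. \<exists>U\<in>\<U>. W \<subseteq> U"
  proof clarify
    fix c U assume "c \<le> d" and U: "U \<in> \<U>"
    have "V c U \<subseteq> U"
    proof clarify
      fix t u assume tu: "(t, u) \<in> V c U"
      then have "(t, u) \<in> pts" "u \<in> K" by (auto simp: V_def pts_def)
      moreover have "D t U u \<noteq> 0"
        using \<Psi>[of t] tu \<open>u \<in> K\<close> by (auto simp: V_def)
      ultimately have "g U (t, u) \<noteq> 0"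
        using U compatible_eq[of t u "g U"] by (simp add: D_def \<phi>_def)
      then show "(t, u) \<in> U"
        using g(2)[OF U] \<open>(t, u) \<in> pts\<close> by auto
    qed
    with U show "\<exists>U'\<in>\<U>. V c U \<subseteq> U'" by blast
  qed
  moreover have "card {W \<in> ?\<V>. p \<in> W} \<le> d + 1" if p: "p \<in> topspace plank_space" for p
  proof -
    obtain t u where tu: "p = (t, u)" by fastforce
    with p have u: "u \<in> K" by (simp add: pts_def)
    define S where "S c = (SOME U. \<Psi> (D t) c U u \<noteq> 0)" for c
    have "U = S c" if "p \<in> V c U" for c U
    proof -
      have nz: "\<Psi> (D t) c U u \<noteq> 0"
        using that tu by (simp add: V_def)
      then have "\<Psi> (D t) c (S c) u \<noteq> 0"
        unfolding S_def by (rule someI)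
      with nz \<Psi>[of t] u show ?thesis by blast
    qed
    then have "{W \<in> ?\<V>. p \<in> W} \<subseteq> (\<lambda>c. V c (S c)) ` {..d}"
      by auto
    then have "card {W \<in> ?\<V>. p \<in> W} \<le> card ((\<lambda>c. V c (S c)) ` {..d})"
      by (intro card_mono) auto
    also have "\<dots> \<le> card {..d}"
      by (rule card_image_le) simp
    finally show ?thesis by simp
  qed
  ultimately show "\<exists>\<V>. finite_cozero_cover plank_space \<V> \<and> (\<forall>V\<in>\<V>. \<exists>U\<in>\<U>. V \<subseteq> U) \<and>
      (\<forall>x\<in>topspace plank_space. card {V \<in> \<V>. x \<in> V} \<le> d + 1)"
    by blast
qed

section \<open>Lower bound: a Sperner labelling from a refinement\<close>

definition coordinates :: "nat \<Rightarrow> (nat \<Rightarrow> 'i \<Rightarrow> real) \<Rightarrow> bool" where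
  "coordinates d q \<longleftrightarrow> (\<forall>i x. 0 \<le> q i x \<and> q i x \<le> 1) \<and>
     (\<forall>i. \<forall>k\<in>{a, b}. ((\<lambda>x. q i x - q i (k x)) \<longlongrightarrow> 0) F)"

text \<open>The cover without a good refinement is the one by the products of the sets \<open>q\<^sub>i \<noteq> 0\<close> or
  \<open>q\<^sub>i \<noteq> 1\<close>. Each grid point is labelled by the member of the refinement whose function is largest
  there. The points of a small set with more than \<open>d\<close> labels become indistinguishable in the
  limit, which then lies in all the members that occur as labels.\<close>

theorem not_covering_dim_le_plank:
  assumes "d \<ge> 1" and levels: "\<And>N. \<exists>x. lev x = N" and q: "coordinates d q"
    and sperner: "\<And>N (sel :: 'i \<Rightarrow> (plank \<times> 'i filter) set) \<sigma>. N \<ge> 1 \<Longrightarrow>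
      (\<And>x i. lev x = N \<Longrightarrow> i < d \<Longrightarrow> (q i x = 1 \<longrightarrow> i \<notin> \<sigma> (sel x)) \<and> (q i x = 0 \<longrightarrow> i \<in> \<sigma> (sel x))) \<Longrightarrow>
      \<exists>S. S \<noteq> {} \<and> (\<forall>x\<in>S. lev x = N) \<and> d < card (sel ` S) \<and>
        (\<forall>g \<delta>. 0 \<le> \<delta> \<longrightarrow> slow_at N \<delta> g \<longrightarrow> (\<forall>x\<in>S. \<forall>y\<in>S. \<bar>g x - g y\<bar> \<le> C * \<delta>))"
  shows "\<not> covering_dim_le plank_space (d - 1)"
proof
  assume dim: "covering_dim_le plank_space (d - 1)"
  have q01: "0 \<le> q i x" "q i x \<le> 1" for i x
    using q by (auto simp: coordinates_def)
  have q_bound: "\<bar>q i x\<bar> \<le> 1" for i x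
    using q01[of i x] by auto
  define f where "f i u = Lim u (q i)" for i u
  have f_lim: "(q i \<longlongrightarrow> f i u) u" if "u \<in> K" for i u
    unfolding f_def by (rule ultra_bounded_tendsto[OF K_ultra[OF that] q_bound])
  have f_cont: "continuous_map plank_space euclideanreal (\<lambda>p. f i (snd p))" for i
  proof (rule continuous_if_compatible)
    have "inv_under k (f i)" if "k \<in> {id, a, b}" for k
      using that q inv_under_Lim[of "q i", OF q_bound] unfolding f_def coordinates_def by auto
    then have "inv_under (e t) (f i)" for t
      by (rule inv_under_e)
    then show "compatible (\<lambda>_. f i)"
      unfolding compatible_def inv_under_def f_def
      using contK_Lim[of "q i", OF q_bound] by auto
  qed simp
  define G where "G \<sigma> p = (\<Prod>i<d. if i \<in> \<sigma> then 1 - f i (snd p) else f i (snd p))" for \<sigma> and p :: "plank \<times> 'i filter"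
  have G_cont: "continuous_map plank_space euclideanreal (G \<sigma>)" for \<sigma>
  proof -
    have factor: "continuous_map plank_space euclideanreal (\<lambda>p. if i \<in> \<sigma> then 1 - f i (snd p) else f i (snd p))" for i
      using f_cont[of i] by (cases "i \<in> \<sigma>") (auto intro!: continuous_map_diff)
    have "continuous_map plank_space euclideanreal (\<lambda>p. \<Prod>i<m. if i \<in> \<sigma> then 1 - f i (snd p) else f i (snd p))" for m :: nat
    proof (induction m)
      case (Suc m)
      show ?case
        unfolding prod.lessThan_Suc by (rule continuous_map_real_mult[OF Suc factor])
    qed simp
    then show ?thesis
      by (simp add: G_def[abs_def])
  qed
  have G_nz: "G \<sigma> p \<noteq> 0 \<longleftrightarrow> (\<forall>i<d. if i \<in> \<sigma> then f i (snd p) \<noteq> 1 else f i (snd p) \<noteq> 0)" for \<sigma> p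
    unfolding G_def by auto
  define U where "U \<sigma> = {p \<in> topspace plank_space. G \<sigma> p \<noteq> 0}" for \<sigma>
  have "finite_cozero_cover plank_space (U ` Pow {..<d})"
    unfolding finite_cozero_cover_def
  proof (intro conjI)
    show "\<forall>W\<in>U ` Pow {..<d}. cozero_set_in plank_space W"
      using G_cont unfolding cozero_set_in_def U_def by blast
    show "\<Union> (U ` Pow {..<d}) = topspace plank_space"
    proof
      show "topspace plank_space \<subseteq> \<Union> (U ` Pow {..<d})"
      proof
        fix p assume p: "p \<in> topspace plank_space"
        \<comment> \<open>A coordinate left out of this index set has the value 1, hence not 0, so
          the point lies in this member of the cover.\<close>
        have "p \<in> U {i. i < d \<and> f i (snd p) \<noteq> 1}"
          using p unfolding U_def G_nz by auto
        moreover have "{i. i < d \<and> f i (snd p) \<noteq> 1} \<in> Pow {..<d}"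
          by auto
        ultimately show "p \<in> \<Union> (U ` Pow {..<d})"
          by (rule UN_I[rotated])
      qed
    qed (auto simp: U_def)
  qed simp
  then obtain \<V> where \<V>: "finite_cozero_cover plank_space \<V>" "\<forall>V\<in>\<V>. \<exists>W\<in>U ` Pow {..<d}. V \<subseteq> W"
    "\<forall>x\<in>topspace plank_space. card {V \<in> \<V>. x \<in> V} \<le> d - 1 + 1"
    using dim unfolding covering_dim_le_def by blast
  then have fin: "finite \<V>" by (simp add: finite_cozero_cover_def)
  have "\<forall>V\<in>\<V>. \<exists>\<sigma>. V \<subseteq> U \<sigma>"
    using \<V>(2) by blast
  then obtain \<sigma> where \<sigma>: "\<And>V. V \<in> \<V> \<Longrightarrow> V \<subseteq> U (\<sigma> V)"
    by metis
  obtain g where g: "\<And>V. V \<in> \<V> \<Longrightarrow> continuous_map plank_space euclideanreal (g V)"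
    "\<And>V. V \<in> \<V> \<Longrightarrow> V = {x \<in> topspace plank_space. g V x \<noteq> 0}"
    using cozero_functions[OF \<V>(1)] by blast
  define \<phi> where "\<phi> V t u = g V (t, filtermap (e t) u)" for V t u
  have \<phi>: "compatible (\<phi> V)" if "V \<in> \<V>" for V
    unfolding \<phi>_def by (rule compatible_if_continuous[OF g(1)[OF that]])
  define D where "D t = (\<lambda>V u. if V \<in> \<V> \<and> u \<in> K then \<phi> V t u else 0)" for t
  have "nb t (\<lambda>s. D s = D t)" for t
  proof -
    have "nb t (\<lambda>s. \<forall>V\<in>\<V>. \<forall>u\<in>K. \<phi> V s u = \<phi> V t u)"
      by (rule nb_ball_finite[OF fin]) (use \<phi> in \<open>auto simp: compatible_def\<close>)
    then show ?thesis
      by (rule nb_mono) (auto simp: D_def fun_eq_iff)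
  qed
  \<comment> \<open>Here the plank acts: the inner fibre imposes no invariance, but its functions
    coincide with those over both edge points and so acquire both invariances.\<close>
  then obtain \<alpha> \<gamma> where eq: "D (Side \<alpha>) = D (Inner \<alpha> \<gamma>)" "D (Roof \<gamma>) = D (Inner \<alpha> \<gamma>)"
    by (rule plank_locally_constant)
  define v where "v V u = g V (Inner \<alpha> \<gamma>, u)" for V u
  have v_Side: "v V u = \<phi> V (Side \<alpha>) u" and v_Roof: "v V u = \<phi> V (Roof \<gamma>) u"
    and v_Inner: "v V u = \<phi> V (Inner \<alpha> \<gamma>) u" if "V \<in> \<V>" "u \<in> K" for V u
    using that fun_cong[OF fun_cong[OF eq(1)], of V u] fun_cong[OF fun_cong[OF eq(2)], of V u]
    by (auto simp: D_def v_def \<phi>_def filtermap_ident id_def)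
  have pt: "(Inner \<alpha> \<gamma>, u) \<in> topspace plank_space" if "u \<in> K" for u
    using that by (simp add: pts_def filtermap_ident id_def)
  have v_mem: "(Inner \<alpha> \<gamma>, u) \<in> V \<longleftrightarrow> v V u \<noteq> 0" if "V \<in> \<V>" "u \<in> K" for V u
    using g(2)[OF that(1)] pt[OF that(2)] by (auto simp: v_def)
  have v_cont: "contK (v V)" if "V \<in> \<V>" for V
    using \<phi>[OF that] contK_cong[of "v V" "\<phi> V (Inner \<alpha> \<gamma>)"] v_Inner[OF that]
    by (simp add: compatible_def)
  have v_a: "inv_under a (v V)" if "V \<in> \<V>" for V
    using \<phi>[OF that] v_Side[OF that] K_filtermap[OF _ lev_a]
    unfolding inv_under_def compatible_def by (metis e.simps(2))
  have v_b: "inv_under b (v V)" if "V \<in> \<V>" for V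
    using \<phi>[OF that] v_Roof[OF that] K_filtermap[OF _ lev_b]
    unfolding inv_under_def compatible_def by (metis e.simps(3))
  have v_cover: "\<exists>V\<in>\<V>. v V u \<noteq> 0" if "u \<in> K" for u
  proof -
    have "(Inner \<alpha> \<gamma>, u) \<in> \<Union>\<V>"
      using pt[OF that] \<V>(1) by (simp add: finite_cozero_cover_def)
    then show ?thesis
      using v_mem[OF _ that] by blast
  qed
  have "\<forall>V\<in>\<V>. \<exists>w. \<forall>u\<in>K. (w \<longlongrightarrow> v V u) u"
    using contK_lift[OF v_cont] by metis
  then obtain w where w: "\<And>V u. V \<in> \<V> \<Longrightarrow> u \<in> K \<Longrightarrow> (w V \<longlongrightarrow> v V u) u"
    by metis
  have "F \<noteq> bot"
    unfolding trivial_limit_def eventually_F_iff using levels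
    by (auto simp: eventually_sequentially)
  then obtain u0 where "u0 \<in> K"
    using ultra_exists by (metis (mono_tags, lifting) K_def mem_Collect_eq)
  with v_cover have ne: "\<V> \<noteq> {}" by blast
  define sel where "sel = argmax \<V> w"
  have sel_in: "sel x \<in> \<V>" for x
    unfolding sel_def by (rule argmax_in[OF fin ne])
  have nonzero: "v V u \<noteq> 0"
    if u: "u \<in> K" and lim: "\<And>V'. V' \<in> \<V> \<Longrightarrow> ((\<lambda>x. w V' (r x)) \<longlongrightarrow> v V' u) u"
      and ev: "eventually (\<lambda>x. sel (r x) = V) u"
    for u r V
  proof -
    obtain V1 where "V1 \<in> \<V>" "v V1 u \<noteq> 0" using v_cover[OF u] by blast
    then show ?thesis
      using argmax_limit_nonzero[OF fin u, of w r "\<lambda>V. v V u" V V1] lim ev by (simp add: sel_def)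
  qed
  \<comment> \<open>At \<open>u\<close> the limit of \<open>q i\<close> differs from the value
    excluded by \<open>\<sigma> V\<close>, and then so does \<open>q i\<close> itself along
    \<open>u\<close>. This is the boundary condition of Sperner's lemma on all high levels.\<close>
  have faces: "eventually (\<lambda>x. \<forall>i\<in>{..<d}. (q i x = 1 \<longrightarrow> i \<notin> \<sigma> (sel x)) \<and> (q i x = 0 \<longrightarrow> i \<in> \<sigma> (sel x))) F"
  proof (intro eventually_ball_finite ballI eventually_F_if_K, simp)
    fix i u assume i: "i \<in> {..<d}" and u: "u \<in> K"
    note ultra = K_ultra[OF u]
    obtain V where V: "V \<in> \<V>" "eventually (\<lambda>x. sel x = V) u"
      using ultra_finite_range[OF ultra fin] sel_in by (meson always_eventually)
    have "v V u \<noteq> 0"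
      using nonzero[OF u, of "\<lambda>x. x"] w u V by simp
    then have "(Inner \<alpha> \<gamma>, u) \<in> U (\<sigma> V)"
      using v_mem[OF V(1) u] \<sigma>[OF V(1)] by blast
    then have f: "if i \<in> \<sigma> V then f i u \<noteq> 1 else f i u \<noteq> 0"
      using i unfolding U_def G_nz by auto
    have "eventually (\<lambda>x. q i x \<noteq> y) u" if "f i u \<noteq> y" for y
      using f_lim[OF u] that by (rule tendsto_imp_eventually_ne)
    then have "eventually (\<lambda>x. if i \<in> \<sigma> V then q i x \<noteq> 1 else q i x \<noteq> 0) u"
      using f by (cases "i \<in> \<sigma> V") auto
    then show "eventually (\<lambda>x. (q i x = 1 \<longrightarrow> i \<notin> \<sigma> (sel x)) \<and> (q i x = 0 \<longrightarrow> i \<in> \<sigma> (sel x))) u"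
      using V(2) by eventually_elim (auto split: if_splits)
  qed
  define P where "P k N \<longleftrightarrow> (\<forall>V\<in>\<V>. slow_at N (1 / real (Suc k)) (w V))" for k N
  have "eventually (P k) sequentially" for k
    unfolding P_def using fin w v_a v_b
    by (intro eventually_ball_finite ballI lift_slow_at) auto
  then obtain \<kappa> where \<kappa>: "filterlim \<kappa> at_top sequentially" "eventually (\<lambda>N. P (\<kappa> N) N) sequentially"
    by (rule diagonal_sequence)
  let ?S = "\<lambda>N S. S \<noteq> {} \<and> (\<forall>x\<in>S. lev x = N) \<and> d < card (sel ` S) \<and>
        (\<forall>g \<delta>. 0 \<le> \<delta> \<longrightarrow> slow_at N \<delta> g \<longrightarrow> (\<forall>x\<in>S. \<forall>y\<in>S. \<bar>g x - g y\<bar> \<le> C * \<delta>))"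
  have ev_S: "eventually (\<lambda>N. \<exists>S. ?S N S) sequentially"
    using faces[unfolded eventually_F_iff] eventually_ge_at_top[of 1]
  proof eventually_elim
    case (elim N)
    then show ?case
      by (intro sperner[of N \<sigma> sel]) auto
  qed
  define S where "S N = (SOME S. ?S N S)" for N
  have S: "eventually (\<lambda>N. ?S N (S N)) sequentially"
    using ev_S unfolding S_def by eventually_elim (rule someI_ex)
  define xs where "xs N = (SOME x. x \<in> S N)" for N
  have xs: "eventually (\<lambda>N. xs N \<in> S N \<and> lev (xs N) = N) sequentially"
    using S
  proof eventually_elim
    case (elim N)
    then have "xs N \<in> S N" unfolding xs_def by (metis some_in_eq)
    with elim show ?case by blast
  qed
  \<comment> \<open>An ultrafilter concentrated on one point from each Sperner set; the levels of
    these points tend to infinity, which puts it into \<open>K\<close>.\<close>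
  have "filtermap xs sequentially \<noteq> bot"
    by (simp add: filtermap_bot_iff)
  then obtain u where u: "u \<le> filtermap xs sequentially" "ultra u"
    by (rule ultra_exists)
  have "filtermap lev (filtermap xs sequentially) \<le> sequentially"
    unfolding filtermap_filtermap
  proof (rule filter_leI)
    fix P :: "nat \<Rightarrow> bool" assume "eventually P sequentially"
    then show "eventually P (filtermap (\<lambda>N. lev (xs N)) sequentially)"
      unfolding eventually_filtermap using xs by eventually_elim auto
  qed
  then have "filtermap xs sequentially \<le> F"
    unfolding F_def by (simp add: filtermap_le_iff_le_filtercomap)
  with u have uK: "u \<in> K"
    by (auto simp: K_def)
  have ev_u: "eventually (\<lambda>x. Q (lev x)) u" if "eventually Q sequentially" for Q
    by (rule K_eventually[OF uK eventually_F_lev[OF that]])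
  have "eventually (\<lambda>x. x \<in> S (lev x)) (filtermap xs sequentially)"
    unfolding eventually_filtermap using xs by eventually_elim auto
  then have x_in: "eventually (\<lambda>x. x \<in> S (lev x)) u"
    using u(1) by (rule filter_leD[rotated])
  \<comment> \<open>Only finitely many sets of labels are possible, so a single one occurs along
    \<open>u\<close>.\<close>
  have "eventually (\<lambda>x. sel ` S (lev x) \<in> Pow \<V>) u"
    using sel_in by (auto intro!: always_eventually)
  from ultra_finite_range[OF u(2) _ this] fin
  obtain \<W> where \<W>: "\<W> \<subseteq> \<V>" "eventually (\<lambda>x. sel ` S (lev x) = \<W>) u"
    by blast
  have "eventually (\<lambda>x. d < card \<W>) u"
    using \<W>(2) ev_u[OF S] by eventually_elim auto
  then have card: "d < card \<W>"
    using ultra_not_bot[OF u(2)] by simp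
  have "v V u \<noteq> 0" if V: "V \<in> \<W>" for V
  proof -
    \<comment> \<open>The point \<open>r x\<close> has label \<open>V\<close> and lies in the same
      Sperner set as \<open>x\<close>, where every lift is nearly constant; so the lifts have the
      same limits at \<open>r x\<close> as at \<open>x\<close>.\<close>
    define r where "r x = (SOME y. y \<in> S (lev x) \<and> sel y = V)" for x
    have r: "eventually (\<lambda>x. r x \<in> S (lev x) \<and> sel (r x) = V) u"
      using \<W>(2)
    proof eventually_elim
      case (elim x)
      then have "\<exists>y. y \<in> S (lev x) \<and> sel y = V" using V by auto
      then show ?case unfolding r_def by (rule someI_ex)
    qed
    have "((\<lambda>x. w V' (r x)) \<longlongrightarrow> v V' u) u" if V': "V' \<in> \<V>" for V'
    proof -
      have "((\<lambda>x. w V' x - w V' (r x)) \<longlongrightarrow> 0) u"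
      proof (rule Lim_null_comparison)
        show "eventually (\<lambda>x. norm (w V' x - w V' (r x)) \<le> C * (1 / real (Suc (\<kappa> (lev x))))) u"
          using r x_in ev_u[OF S] ev_u[OF \<kappa>(2)]
        proof eventually_elim
          case (elim x)
          from elim(4) have "slow_at (lev x) (1 / real (Suc (\<kappa> (lev x)))) (w V')"
            using V' unfolding P_def by blast
          then show ?case
            unfolding real_norm_def
            by (intro elim(3)[THEN conjunct2, THEN conjunct2, THEN conjunct2, rule_format]
                elim(1)[THEN conjunct1] elim(2)) simp_all
        qed
        have "(\<lambda>n. 1 / real (Suc n)) \<longlonglongrightarrow> 0"
          using LIMSEQ_inverse_real_of_nat by (simp add: inverse_eq_divide)
        then have "((\<lambda>x. 1 / real (Suc (\<kappa> (lev x)))) \<longlongrightarrow> 0) u"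
          by (intro tendsto_K[OF uK] filterlim_compose[OF _ filterlim_F_lev[OF \<kappa>(1)]])
        then show "((\<lambda>x. C * (1 / real (Suc (\<kappa> (lev x))))) \<longlongrightarrow> 0) u"
          by (rule tendsto_mult_right_zero)
      qed
      from tendsto_diff[OF w[OF V' uK] this] show ?thesis by simp
    qed
    moreover have "eventually (\<lambda>x. sel (r x) = V) u"
      using r by eventually_elim simp
    ultimately show ?thesis
      by (rule nonzero[OF uK])
  qed
  then have "\<W> \<subseteq> {V \<in> \<V>. (Inner \<alpha> \<gamma>, u) \<in> V}"
    using \<W>(1) v_mem[OF _ uK] by blast
  then have "card \<W> \<le> card {V \<in> \<V>. (Inner \<alpha> \<gamma>, u) \<in> V}"
    using fin by (intro card_mono) auto
  also have "\<dots> \<le> d - 1 + 1"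
    using \<V>(3) pt[OF uK] by blast
  finally show False
    using card \<open>d \<ge> 1\<close> by simp
qed

end


subsection \<open>Grids\<close>

type_synonym grid = "nat \<times> (nat \<Rightarrow> nat)"

text \<open>Clipping makes every element of the type \<open>grid\<close> represent a point of \<open>{0..N}\<^sup>d\<close>, where \<open>N\<close> is
  its first component.\<close>

definition crd :: "grid \<Rightarrow> nat \<Rightarrow> nat" where
  "crd x i = min (fst x) (snd x i)"

text \<open>A block is represented by its least point; entries from \<open>d\<close> on are set to 0
  so that differences there do not matter.\<close>

definition even_blocks :: "nat \<Rightarrow> grid \<Rightarrow> grid" where
  "even_blocks d x = (fst x, \<lambda>i. if i < d then 2 * (crd x i div 2) else 0)"

text \<open>Truncated subtraction makes 0 the representative of the block \<open>{-1, 0}\<close>, of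
  which only 0 lies in the grid.\<close>

definition odd_blocks :: "nat \<Rightarrow> grid \<Rightarrow> grid" where
  "odd_blocks d x = (fst x, \<lambda>i. if i < d then 2 * ((crd x i + 1) div 2) - 1 else 0)"

lemma crd_le: "crd x i \<le> fst x"
  by (simp add: crd_def)

lemma fst_blocks [simp]: "fst (even_blocks d x) = fst x" "fst (odd_blocks d x) = fst x"
  by (simp_all add: even_blocks_def odd_blocks_def)

lemma crd_even_blocks: "i < d \<Longrightarrow> crd (even_blocks d x) i = 2 * (crd x i div 2)"
  using crd_le[of x i] by (simp add: crd_def even_blocks_def)

lemma crd_odd_blocks: "i < d \<Longrightarrow> crd (odd_blocks d x) i = 2 * ((crd x i + 1) div 2) - 1"
  using crd_le[of x i] by (simp add: crd_def odd_blocks_def)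

lemma even_blocks_cong:
  "fst x = fst y \<Longrightarrow> (\<And>i. i < d \<Longrightarrow> crd x i div 2 = crd y i div 2) \<Longrightarrow> even_blocks d x = even_blocks d y"
  by (auto simp: even_blocks_def fun_eq_iff)

lemma odd_blocks_cong:
  "fst x = fst y \<Longrightarrow> (\<And>i. i < d \<Longrightarrow> (crd x i + 1) div 2 = (crd y i + 1) div 2) \<Longrightarrow>
    odd_blocks d x = odd_blocks d y"
  by (auto simp: odd_blocks_def fun_eq_iff)

lemma two_partitions_blocks: "two_partitions fst (even_blocks d) (odd_blocks d)"
proof
  show "even_blocks d (even_blocks d x) = even_blocks d x" for x
    by (rule even_blocks_cong) (simp_all add: crd_even_blocks)
  show "odd_blocks d (odd_blocks d x) = odd_blocks d x" for x
  proof (rule odd_blocks_cong)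
    fix i assume "i < d"
    have "(2 * ((c + 1) div 2) - 1 + 1) div 2 = (c + 1) div 2" for c :: nat
      by (cases "(c + 1) div 2") auto
    with \<open>i < d\<close> show "(crd (odd_blocks d x) i + 1) div 2 = (crd x i + 1) div 2"
      by (simp only: crd_odd_blocks)
  qed simp
qed simp_all

lemma crd_blocks_near:
  assumes "k \<in> {even_blocks d, odd_blocks d}" "i < d"
  shows "crd x i = crd (k x) i \<or> crd x i = Suc (crd (k x) i)"
proof -
  have "c = 2 * (c div 2) \<or> c = Suc (2 * (c div 2))" for c :: nat
    by presburger
  moreover have "c = 2 * ((c + 1) div 2) - 1 \<or> c = Suc (2 * ((c + 1) div 2) - 1)" for c :: nat
    by presburger
  ultimately show ?thesis
    using assms crd_even_blocks[of i d x] crd_odd_blocks[of i d x] by auto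
qed

text \<open>The l1 distance: in each summand one of the truncated differences is 0 and the other is
  the absolute difference.\<close>

definition grid_dist :: "nat \<Rightarrow> grid \<Rightarrow> grid \<Rightarrow> nat" where
  "grid_dist d x y = (\<Sum>i<d. (crd x i - crd y i) + (crd y i - crd x i))"

text \<open>The numbers \<open>m\<close> and \<open>m + 1\<close> share a block of the even
  partition if \<open>m\<close> is even, and of the odd one if \<open>m\<close> is odd; so the two
  partitions together link all grid neighbours.\<close>

lemma blocks_adjacent:
  assumes "fst x = fst y" "i < d" "\<And>j. j < d \<Longrightarrow> j \<noteq> i \<Longrightarrow> crd x j = crd y j" "crd y i = Suc (crd x i)"
  shows "even_blocks d x = even_blocks d y \<or> odd_blocks d x = odd_blocks d y"
proof (cases "even (crd x i)")
  case True
  have "even_blocks d x = even_blocks d y"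
  proof (rule even_blocks_cong[OF assms(1)])
    fix j assume "j < d"
    then show "crd x j div 2 = crd y j div 2"
      using True assms(3)[of j] assms(4) by (cases "j = i") auto
  qed
  then show ?thesis ..
next
  case False
  have "odd_blocks d x = odd_blocks d y"
  proof (rule odd_blocks_cong[OF assms(1)])
    fix j assume "j < d"
    then show "(crd x j + 1) div 2 = (crd y j + 1) div 2"
      using False assms(3)[of j] assms(4) by (cases "j = i") (auto elim!: oddE)
  qed
  then show ?thesis ..
qed

context
  fixes d :: nat
begin

interpretation two_partitions fst "even_blocks d" "odd_blocks d"
  by (rule two_partitions_blocks)

lemma slow_at_blocks:
  assumes "slow_at N \<delta> g" "fst x = N" "fst y = N"
    and "even_blocks d x = even_blocks d y \<or> odd_blocks d x = odd_blocks d y"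
  shows "\<bar>g x - g y\<bar> \<le> 2 * \<delta>"
proof -
  have "\<bar>g z - g (even_blocks d z)\<bar> \<le> \<delta>" "\<bar>g z - g (odd_blocks d z)\<bar> \<le> \<delta>" if "fst z = N" for z
    using assms(1) that unfolding slow_at_def by blast+
  from this[OF assms(2)] this[OF assms(3)] assms(4) show ?thesis
    by (smt (verit))
qed

text \<open>Each unit step passes through a common representative and costs
  \<open>2 * \<delta>\<close>. The extra summand 1 pays for distinct elements of \<open>grid\<close>
  that have the same coordinates.\<close>

lemma slow_at_grid_dist:
  assumes slow: "slow_at N \<delta> g" and "0 \<le> \<delta>" and "fst x = N" "fst y = N"
  shows "\<bar>g x - g y\<bar> \<le> 2 * (real (grid_dist d x y) + 1) * \<delta>"
  using assms(3)
proof (induction "grid_dist d x y" arbitrary: x)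
  case 0
  then have "crd x i = crd y i" if "i < d" for i
    using that by (intro antisym) (auto simp: grid_dist_def)
  then have "even_blocks d x = even_blocks d y"
    using 0 \<open>fst y = N\<close> by (intro even_blocks_cong) auto
  then have "\<bar>g x - g y\<bar> \<le> 2 * \<delta>"
    using slow_at_blocks[OF slow] 0 \<open>fst y = N\<close> by blast
  then show ?case
    using 0 by simp
next
  case (Suc n)
  then have "grid_dist d x y \<noteq> 0" by simp
  then obtain i where i: "i < d" "crd x i \<noteq> crd y i"
    unfolding grid_dist_def by (auto simp: sum_eq_0_iff)
  \<comment> \<open>One step of the \<open>i\<close>-th coordinate towards \<open>y\<close>.\<close>
  define c where "c = (if crd x i < crd y i then Suc (crd x i) else crd x i - 1)"
  define x' where "x' = (N, (\<lambda>j. crd x j)(i := c))"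
  have c_le: "c \<le> N"
    using crd_le[of y i] crd_le[of x i] \<open>fst y = N\<close> \<open>fst x = N\<close> by (auto simp: c_def)
  have crd_x': "crd x' j = (if j = i then c else crd x j)" for j
    using c_le crd_le[of x j] \<open>fst x = N\<close> by (auto simp: x'_def crd_def)
  have fst_x': "fst x' = N" by (simp add: x'_def)
  have "grid_dist d x y = Suc (grid_dist d x' y)"
    unfolding grid_dist_def sum.remove[OF finite_lessThan, of i d, unfolded lessThan_iff, OF i(1)]
    using i(2) by (auto simp: crd_x' c_def)
  with Suc.hyps(2) have n: "n = grid_dist d x' y" by simp
  have "(crd x' i = Suc (crd x i)) \<or> (crd x i = Suc (crd x' i))"
    using i(2) by (auto simp: crd_x' c_def)
  then have "even_blocks d x = even_blocks d x' \<or> odd_blocks d x = odd_blocks d x'"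
    using blocks_adjacent[of x x' i d] blocks_adjacent[of x' x i d] i(1) \<open>fst x = N\<close>
    by (auto simp: fst_x' crd_x')
  then have "\<bar>g x - g x'\<bar> \<le> 2 * \<delta>"
    by (rule slow_at_blocks[OF slow \<open>fst x = N\<close> fst_x'])
  moreover have "\<bar>g x' - g y\<bar> \<le> 2 * (real n + 1) * \<delta>"
    using Suc.hyps(1)[OF n fst_x'] n by simp
  moreover have "2 * (real (Suc n) + 1) * \<delta> = 2 * \<delta> + 2 * (real n + 1) * \<delta>"
    by (simp add: algebra_simps)
  ultimately show ?case
    unfolding Suc.hyps(2)[symmetric] by linarith
qed

text \<open>Colour \<open>c\<close> cuts the line at the numbers congruent to \<open>c * L\<close> modulo \<open>(d + 1) * L\<close>; adding
  \<open>c * d * L\<close> moves these cuts to the multiples of \<open>(d + 1) * L\<close> without subtraction. A number is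
  close to a cut of at most one of the colours \<open>0..d\<close>, so \<open>d\<close> coordinates spoil at most \<open>d\<close> of
  the \<open>d + 1\<close> colours.\<close>

definition gap_dist :: "nat \<Rightarrow> nat \<Rightarrow> nat" where
  "gap_dist L s = min L (min (s mod (Suc d * L)) (Suc d * L - s mod (Suc d * L)))"

definition shifted :: "nat \<Rightarrow> nat \<Rightarrow> nat \<Rightarrow> nat" where
  "shifted L c t = t + c * d * L"

text \<open>The minimum vanishes as soon as one coordinate lies on a cut, which is what separates
  the pieces; the cap \<open>L\<close> in \<open>gap_dist\<close> keeps the values at most
  1.\<close>

definition bump :: "nat \<Rightarrow> nat \<Rightarrow> grid \<Rightarrow> real" where
  "bump L c x = real (Min ((\<lambda>i. gap_dist L (shifted L c (crd x i))) ` {..<d})) / real L"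

definition piece :: "nat \<Rightarrow> nat \<Rightarrow> grid \<Rightarrow> nat \<Rightarrow> nat" where
  "piece L c x = (\<lambda>i. if i < d then shifted L c (crd x i) div (Suc d * L) else 0)"

text \<open>The capped distance to the nearest cut changes by at most 1 per step, and of two
  consecutive numbers with different quotients the larger lies on a cut.\<close>

lemma gap_dist_Suc:
  assumes "L \<ge> 1"
  shows "gap_dist L s \<le> gap_dist L (Suc s) + 1" "gap_dist L (Suc s) \<le> gap_dist L s + 1"
    and "s div (Suc d * L) \<noteq> Suc s div (Suc d * L) \<Longrightarrow> gap_dist L s \<le> 1 \<and> gap_dist L (Suc s) \<le> 1"
proof -
  define M where "M = Suc d * L"
  have "M > 0" using assms by (simp add: M_def)
  then have r: "s mod M < M" by simp
  show "gap_dist L s \<le> gap_dist L (Suc s) + 1" "gap_dist L (Suc s) \<le> gap_dist L s + 1"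
    "s div (Suc d * L) \<noteq> Suc s div (Suc d * L) \<Longrightarrow> gap_dist L s \<le> 1 \<and> gap_dist L (Suc s) \<le> 1"
    using r unfolding gap_dist_def M_def[symmetric] mod_Suc div_Suc by (auto split: if_splits)
qed

text \<open>Cuts of different colours are at least \<open>L\<close> apart, so no number is closer
  than \<open>L / 2\<close> to both.\<close>

lemma gap_dist_unique:
  assumes "L \<ge> 1" "2 * gap_dist L (shifted L c t) < L" "2 * gap_dist L (shifted L c' t) < L" "c \<le> d" "c' \<le> d"
  shows "c = c'"
proof -
  define M where "M = Suc d * L"
  \<comment> \<open>Up to a multiple of the period \<open>M\<close>, adding \<open>c * d * L\<close>
    subtracts \<open>c * L\<close>; in the integers the cuts of colour \<open>c\<close> are
    therefore the numbers \<open>c * L + k * M\<close>.\<close>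
  have near: "\<exists>k::int. 2 * \<bar>int t - int c * int L - k * int M\<bar> < int L" if "2 * gap_dist L (shifted L c t) < L" for c
  proof -
    define s where "s = shifted L c t"
    have M: "int (s mod M) = int s - int M * int (s div M)"
      by (simp add: minus_mult_div_eq_mod zmod_int zdiv_int)
    have s: "int s = int t + int c * int M - int c * int L"
      by (simp add: s_def shifted_def M_def algebra_simps)
    have lt: "s mod M < M" using assms(1) by (simp add: M_def)
    have "2 * (s mod M) < L \<or> 2 * (M - s mod M) < L"
      using that unfolding gap_dist_def s_def[symmetric] M_def[symmetric] by (auto simp: min_def split: if_splits)
    then show ?thesis
    proof
      assume *: "2 * (s mod M) < L"
      have "int t - int c * int L - (int (s div M) - int c) * int M = int (s mod M)"
        using M s by (simp add: algebra_simps)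
      with * show ?thesis by (intro exI[of _ "int (s div M) - int c"]) simp
    next
      assume *: "2 * (M - s mod M) < L"
      have "int t - int c * int L - (int (s div M) + 1 - int c) * int M = - int (M - s mod M)"
        using M s lt by (simp add: algebra_simps of_nat_diff)
      with * show ?thesis by (intro exI[of _ "int (s div M) + 1 - int c"]) simp
    qed
  qed
  from near[OF assms(2)] near[OF assms(3)] obtain k k' where
    "2 * \<bar>int t - int c * int L - k * int M\<bar> < int L" "2 * \<bar>int t - int c' * int L - k' * int M\<bar> < int L"
    by blast
  moreover have "\<bar>X - Y\<bar> < l" if "2 * \<bar>X\<bar> < l" "2 * \<bar>Y\<bar> < l" for X Y l :: int
    using that by linarith
  ultimately have "\<bar>(int t - int c * int L - k * int M) - (int t - int c' * int L - k' * int M)\<bar> < int L"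
    by blast
  \<comment> \<open>A multiple of \<open>L\<close> of absolute value below \<open>L\<close> is 0, so
    \<open>c\<close> and \<open>c'\<close> are congruent modulo \<open>d + 1\<close>; both are at
    most \<open>d\<close>.\<close>
  moreover have "(int t - int c * int L - k * int M) - (int t - int c' * int L - k' * int M) =
      int L * (int c' - int c + (k' - k) * int (Suc d))"
    by (simp add: M_def algebra_simps)
  ultimately have "\<bar>int c' - int c + (k' - k) * int (Suc d)\<bar> < 1"
    using assms(1) by (simp add: abs_mult)
  then have eq: "int c' - int c = (k - k') * int (Suc d)"
    by (simp add: algebra_simps)
  then have "int (Suc d) dvd int c' - int c" by simp
  moreover have "\<bar>int c' - int c\<bar> < int (Suc d)"
    using assms(4,5) by auto
  ultimately have "int c' - int c = 0"
    using zdvd_imp_le[of "int (Suc d)" "\<bar>int c' - int c\<bar>"] by (cases "int c' - int c = 0") auto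
  then show ?thesis by simp
qed

text \<open>On a piece each of the \<open>d\<close> coordinates varies by at most
  \<open>(d + 1) * L\<close>; \<open>slow_at_grid_dist\<close> turns this into the last argument of
  \<open>cells\<close>.\<close>

lemma cells_grid:
  assumes "d \<ge> 1"
  shows "cells d bump piece (\<lambda>L. 2 * (real (d * (Suc d * L)) + 1))"
  unfolding cells_def
proof (intro allI impI)
  fix L :: nat assume L: "L \<ge> 1"
  let ?\<rho> = "\<lambda>c x i. gap_dist L (shifted L c (crd x i))"
  let ?m = "\<lambda>c x. Min (?\<rho> c x ` {..<d})"
  have fin: "finite (?\<rho> c x ` {..<d})" "?\<rho> c x ` {..<d} \<noteq> {}" for c x
    using assms by (auto simp: lessThan_empty_iff)
  have m_le: "?m c x \<le> ?\<rho> c x i" if "i < d" for c x i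
    using that fin by (intro Min_le) auto
  have m_in: "\<exists>i<d. ?m c x = ?\<rho> c x i" for c x
    using Min_in[OF fin[of c x]] by auto
  have bounds: "0 \<le> bump L c x \<and> bump L c x \<le> 1" for c x
  proof -
    obtain i where "?m c x = ?\<rho> c x i" using m_in by blast
    then have "?m c x \<le> L" by (simp add: gap_dist_def)
    then show ?thesis using L by (simp add: bump_def)
  qed
  have cover: "\<exists>c\<le>d. 1 / 2 \<le> bump L c x" for x
  proof -
    let ?bad = "\<lambda>i. {c. c \<le> d \<and> 2 * ?\<rho> c x i < L}"
    have "card (\<Union>i<d. ?bad i) \<le> (\<Sum>i<d. card (?bad i))"
      by (rule card_UN_le) simp
    also have "\<dots> \<le> (\<Sum>i<d. 1)"
    proof (rule sum_mono)
      fix i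
      have "finite (?bad i)" by simp
      then show "card (?bad i) \<le> 1"
        using gap_dist_unique[OF L] by (auto simp: card_le_Suc0_iff_eq)
    qed
    finally have "card (\<Union>i<d. ?bad i) \<le> d" by simp
    then have "\<not> {..d} \<subseteq> (\<Union>i<d. ?bad i)"
      using card_mono[of "\<Union>i<d. ?bad i" "{..d}"] by auto
    then obtain c where "c \<le> d" "c \<notin> (\<Union>i<d. ?bad i)"
      by blast
    then have c: "c \<le> d" "\<And>i. i < d \<Longrightarrow> L \<le> 2 * ?\<rho> c x i"
      by (auto simp: not_less)
    then have "L \<le> 2 * ?m c x"
      using m_in[of c x] by auto
    then have "real L \<le> 2 * real (?m c x)" by linarith
    with L have "1 / 2 \<le> bump L c x"
      by (simp add: bump_def field_simps)
    with c(1) show ?thesis by blast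
  qed
  have step: "\<bar>bump L c x - bump L c (k x)\<bar> \<le> 1 / real L \<and>
      (piece L c x \<noteq> piece L c (k x) \<longrightarrow> bump L c x \<le> 1 / real L \<and> bump L c (k x) \<le> 1 / real L)"
    if k: "k \<in> {even_blocks d, odd_blocks d}" for k c x
  proof -
    have near: "shifted L c (crd x i) = shifted L c (crd (k x) i) \<or>
        shifted L c (crd x i) = Suc (shifted L c (crd (k x) i))" if "i < d" for i
      using crd_blocks_near[OF k that, of x] by (auto simp: shifted_def)
    have rho: "?\<rho> c x i \<le> ?\<rho> c (k x) i + 1" "?\<rho> c (k x) i \<le> ?\<rho> c x i + 1" if "i < d" for i
      using near[OF that] gap_dist_Suc(1,2)[OF L, of "shifted L c (crd (k x) i)"] by auto
    obtain i j where ij: "i < d" "?m c x = ?\<rho> c x i" "j < d" "?m c (k x) = ?\<rho> c (k x) j"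
      using m_in by blast
    have "?m c x \<le> ?m c (k x) + 1" "?m c (k x) \<le> ?m c x + 1"
      using m_le[of j c x] m_le[of i c "k x"] rho[of i] rho[of j] ij by linarith+
    then have "\<bar>real (?m c x) - real (?m c (k x))\<bar> \<le> 1" by linarith
    then have 1: "\<bar>bump L c x - bump L c (k x)\<bar> \<le> 1 / real L"
      using L unfolding bump_def diff_divide_distrib[symmetric] abs_divide
      by (simp add: divide_right_mono)
    have 2: "bump L c x \<le> 1 / real L \<and> bump L c (k x) \<le> 1 / real L" if ne: "piece L c x \<noteq> piece L c (k x)"
    proof -
      obtain i where "piece L c x i \<noteq> piece L c (k x) i"
        using ne by blast
      then have i: "i < d"
        "shifted L c (crd x i) div (Suc d * L) \<noteq> shifted L c (crd (k x) i) div (Suc d * L)"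
        unfolding piece_def by metis+
      then have "shifted L c (crd x i) = Suc (shifted L c (crd (k x) i))"
        using near[OF i(1)] by metis
      then have "?\<rho> c x i \<le> 1" "?\<rho> c (k x) i \<le> 1"
        using gap_dist_Suc(3)[OF L, of "shifted L c (crd (k x) i)"] i(2) by auto
      then have "?m c x \<le> 1" "?m c (k x) \<le> 1"
        using m_le[OF i(1), of c x] m_le[OF i(1), of c "k x"] by linarith+
      then have "real (?m c x) \<le> 1" "real (?m c (k x)) \<le> 1" by linarith+
      then show ?thesis
        unfolding bump_def by (simp add: divide_right_mono)
    qed
    from 1 2 show ?thesis by blast
  qed
  have diam: "\<bar>g x - g y\<bar> \<le> 2 * (real (d * (Suc d * L)) + 1) * \<delta>"
    if "fst x = fst y" "piece L c x = piece L c y" "0 \<le> \<delta>" "slow_at (fst x) \<delta> g" for c x y g \<delta>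
  proof -
    have "(crd x i - crd y i) + (crd y i - crd x i) \<le> Suc d * L" if "i < d" for i
    proof -
      let ?M = "Suc d * L"
      have M: "?M > 0" using L by simp
      have eq: "shifted L c (crd x i) div ?M = shifted L c (crd y i) div ?M"
        using fun_cong[OF \<open>piece L c x = piece L c y\<close>, of i] that by (simp add: piece_def)
      have "s - s' \<le> ?M" if "s div ?M = s' div ?M" for s s'
      proof -
        have "s = ?M * (s div ?M) + s mod ?M" "s' = ?M * (s div ?M) + s' mod ?M"
          using that by (metis mult_div_mod_eq)+
        moreover have "s mod ?M < ?M" using M by simp
        ultimately show ?thesis by linarith
      qed
      from this[OF eq] this[OF eq[symmetric]] show ?thesis
        by (auto simp: shifted_def)
    qed
    then have "grid_dist d x y \<le> (\<Sum>i<d. Suc d * L)"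
      unfolding grid_dist_def by (intro sum_mono) auto
    then have "grid_dist d x y \<le> d * (Suc d * L)" by simp
    then have "real (grid_dist d x y) \<le> real (d * (Suc d * L))"
      by (rule of_nat_mono)
    then have "2 * (real (grid_dist d x y) + 1) * \<delta> \<le> 2 * (real (d * (Suc d * L)) + 1) * \<delta>"
      using that(3) by (intro mult_right_mono) auto
    then show ?thesis
      using slow_at_grid_dist[OF that(4,3) refl that(1)[symmetric]] by linarith
  qed
  show "(\<forall>c x. 0 \<le> bump L c x \<and> bump L c x \<le> 1) \<and> (\<forall>x. \<exists>c\<le>d. 1 / 2 \<le> bump L c x) \<and>
    (\<forall>k\<in>{even_blocks d, odd_blocks d}. \<forall>c x. \<bar>bump L c x - bump L c (k x)\<bar> \<le> 1 / real L \<and>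
      (piece L c x \<noteq> piece L c (k x) \<longrightarrow> bump L c x \<le> 1 / real L \<and> bump L c (k x) \<le> 1 / real L)) \<and>
    (\<forall>c x y g \<delta>. fst x = fst y \<longrightarrow> piece L c x = piece L c y \<longrightarrow> 0 \<le> \<delta> \<longrightarrow> slow_at (fst x) \<delta> g \<longrightarrow>
      \<bar>g x - g y\<bar> \<le> 2 * (real (d * (Suc d * L)) + 1) * \<delta>)"
    using bounds cover step diam by (intro conjI) blast+
qed

section \<open>Scaled coordinates and Sperner's lemma\<close>

definition coordinate :: "nat \<Rightarrow> grid \<Rightarrow> real" where
  "coordinate i x = (if i < d then real (crd x i) / real (fst x) else 0)"

text \<open>A representative differs from its point by at most 1 in each coordinate, hence by at
  most \<open>1 / N\<close> after scaling; from index \<open>d\<close> on the coordinate is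
  constantly 0.\<close>

lemma coordinates_grid: "coordinates d coordinate"
  unfolding coordinates_def
proof (intro conjI allI ballI)
  fix i x
  show "0 \<le> coordinate i x" by (simp add: coordinate_def)
  show "coordinate i x \<le> 1"
    using crd_le[of x i] by (simp add: coordinate_def divide_le_eq)
next
  fix i k assume k: "k \<in> {even_blocks d, odd_blocks d}"
  then have fst_k: "fst (k x) = fst x" for x by auto
  show "((\<lambda>x. coordinate i x - coordinate i (k x)) \<longlongrightarrow> 0) F"
  proof (rule Lim_null_comparison)
    have "norm (coordinate i x - coordinate i (k x)) \<le> 1 / real (fst x)" for x
    proof (cases "i < d")
      case True
      then have "\<bar>real (crd x i) - real (crd (k x) i)\<bar> \<le> 1"
        using crd_blocks_near[OF k True, of x] by auto
      then show ?thesis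
        using True unfolding coordinate_def fst_k
        by (simp add: divide_right_mono flip: diff_divide_distrib)
    qed (simp add: coordinate_def)
    then show "eventually (\<lambda>x. norm (coordinate i x - coordinate i (k x)) \<le> 1 / real (fst x)) F"
      by simp
    show "((\<lambda>x. 1 / real (fst x)) \<longlongrightarrow> 0) F"
      using filterlim_F_lev[OF lim_1_over_n] by simp
  qed
qed

text \<open>Kuhn's cubical form of Sperner's lemma, known from the proof of Brouwer's theorem,
  yields an odd number of fully labelled simplices, hence at least one.\<close>

lemma sperner_grid:
  fixes sel :: "grid \<Rightarrow> 's" and \<sigma> :: "'s \<Rightarrow> nat set"
  assumes "N \<ge> 1" and face: "\<And>x i. fst x = N \<Longrightarrow> i < d \<Longrightarrow>
    (coordinate i x = 1 \<longrightarrow> i \<notin> \<sigma> (sel x)) \<and> (coordinate i x = 0 \<longrightarrow> i \<in> \<sigma> (sel x))"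
  shows "\<exists>S. S \<noteq> {} \<and> (\<forall>x\<in>S. fst x = N) \<and> d < card (sel ` S) \<and>
    (\<forall>g \<delta>. 0 \<le> \<delta> \<longrightarrow> slow_at N \<delta> g \<longrightarrow> (\<forall>x\<in>S. \<forall>y\<in>S. \<bar>g x - g y\<bar> \<le> (2 * (real d + 1)) * \<delta>))"
proof -
  \<comment> \<open>Membership in \<open>\<sigma>\<close> gives label 0, since it is forced where
    the coordinate is 0 and excluded where it is 1.\<close>
  define lab where "lab x j = (if j \<in> \<sigma> (sel (N, x)) then 0 else 1 :: nat)" for x j
  have "odd (card {s. ksimplex N d s \<and> (reduced d \<circ> lab) ` s = {..d}})"
  proof (rule kuhn_combinatorial)
    show "0 < N" using assms(1) by simp
    show "\<forall>x j. (\<forall>j. x j \<le> N) \<and> j < d \<and> x j = 0 \<longrightarrow> lab x j = 0"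
    proof clarify
      fix x j assume "j < d" "x j = (0::nat)"
      then have "coordinate j (N, x) = 0"
        by (simp add: coordinate_def crd_def)
      then show "lab x j = 0"
        using face[of "(N, x)" j] \<open>j < d\<close> by (simp add: lab_def)
    qed
    show "\<forall>x j. (\<forall>j. x j \<le> N) \<and> j < d \<and> x j = N \<longrightarrow> lab x j = 1"
    proof clarify
      fix x j assume "j < d" "N = x j"
      then have "coordinate j (N, x) = 1"
        using assms(1) by (simp add: coordinate_def crd_def)
      then show "lab x j = 1"
        using face[of "(N, x)" j] \<open>j < d\<close> by (simp add: lab_def)
    qed
  qed
  then have "{s. ksimplex N d s \<and> (reduced d \<circ> lab) ` s = {..d}} \<noteq> {}"
    by (metis card.empty even_zero)
  then obtain s where s: "ksimplex N d s" "(reduced d \<circ> lab) ` s = {..d}"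
    by blast
  have "card s = Suc d"
    by (rule ksimplex_card[OF s(1)])
  then have fin: "finite s" and ne: "s \<noteq> {}"
    by (auto simp: card_ge_0_finite)
  obtain base upd where "kuhn_simplex N d base upd s"
    using s(1) by (auto elim: ksimplex.cases)
  then interpret kuhn_simplex N d base upd s .
  let ?S = "Pair N ` s"
  \<comment> \<open>The reduced label, which is the first coordinate labelled 1 or else
    \<open>d\<close>, depends only on the value of \<open>sel\<close>; so \<open>d + 1\<close>
    reduced labels require \<open>d + 1\<close> values.\<close>
  have "(\<lambda>V. reduced d (\<lambda>j. if j \<in> \<sigma> V then 0 else 1)) ` sel ` ?S = {..d}"
    unfolding s(2)[symmetric] image_image lab_def[abs_def] comp_def ..
  then have "card {..d} \<le> card (sel ` ?S)"
    using fin by (metis card_image_le finite_imageI)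
  then have card: "d < card (sel ` ?S)" by simp
  have "grid_dist d x y \<le> d" if xy: "x \<in> ?S" "y \<in> ?S" for x y
  proof -
    obtain p p' where p: "x = (N, p)" "y = (N, p')" "p \<in> s" "p' \<in> s"
      using xy by auto
    \<comment> \<open>All vertices of a Kuhn simplex lie in one unit cube above
      \<open>base\<close>.\<close>
    have "(crd x i - crd y i) + (crd y i - crd x i) \<le> 1" for i
      using le_Suc_base[OF p(3), of i] base_le[OF p(3), of i] le_Suc_base[OF p(4), of i]
        base_le[OF p(4), of i] s_le_p[OF p(3), of i] s_le_p[OF p(4), of i] p(1,2)
      by (simp add: crd_def)
    then have "grid_dist d x y \<le> (\<Sum>i<d. 1)"
      unfolding grid_dist_def by (intro sum_mono)
    then show ?thesis by simp
  qed
  then have dist: "2 * (real (grid_dist d x y) + 1) * \<delta> \<le> 2 * (real d + 1) * \<delta>"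
    if "x \<in> ?S" "y \<in> ?S" "0 \<le> \<delta>" for x y \<delta>
    using that by (intro mult_right_mono) auto
  have "\<bar>g x - g y\<bar> \<le> (2 * (real d + 1)) * \<delta>"
    if "0 \<le> \<delta>" "slow_at N \<delta> g" "x \<in> ?S" "y \<in> ?S" for g \<delta> x y
    using slow_at_grid_dist[OF that(2,1), of x y] dist[OF that(3,4,1)] that(3,4) by fastforce
  with card ne show ?thesis
    by (intro exI[of _ ?S]) auto
qed

lemma covering_dim_grid:
  assumes "d \<ge> 1"
  shows "covering_dim plank_space = enat d"
proof (rule antisym)
  show "covering_dim plank_space \<le> enat d"
    unfolding covering_dim_le_iff by (rule covering_dim_le_plank[OF cells_grid[OF assms]])
  have "\<not> covering_dim_le plank_space (d - 1)"
  proof (rule not_covering_dim_le_plank[OF assms _ coordinates_grid])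
    show "\<exists>x :: grid. fst x = N" for N by auto
  qed (rule sperner_grid)
  then have "\<not> covering_dim plank_space \<le> enat (d - 1)"
    unfolding covering_dim_le_iff .
  then show "enat d \<le> covering_dim plank_space"
    using assms by (cases "covering_dim plank_space") auto
qed

lemma plank_space_example:
  assumes "d \<ge> 1"
  shows "\<exists>X :: (plank \<times> grid filter) topology.
    tychonoff_space X \<and> zero_dimensional_space X \<and> F_space X \<and> covering_dim X = enat d"
  using tychonoff_plank zero_dimensional_plank F_space_plank covering_dim_grid[OF assms] by blast

end


subsection \<open>Homeomorphic copies\<close>

lemma continuous_map_vimage_cozero:
  assumes "continuous_map Y X g" "cozero_set_in X V"
  shows "cozero_set_in Y {y \<in> topspace Y. g y \<in> V}"
proof -
  obtain h where h: "continuous_map X euclideanreal h" "V = {x \<in> topspace X. h x \<noteq> 0}"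
    using assms(2) unfolding cozero_set_in_def by blast
  have "continuous_map Y euclideanreal (h \<circ> g)"
    using assms(1) h(1) by (rule continuous_map_compose)
  moreover have "{y \<in> topspace Y. g y \<in> V} = {y \<in> topspace Y. (h \<circ> g) y \<noteq> 0}"
    using assms(1) h(2) by (auto simp: continuous_map_def Pi_iff)
  ultimately show ?thesis
    unfolding cozero_set_in_def by blast
qed

lemma continuous_map_vimage_finite_cozero_cover:
  assumes "continuous_map Y X g" "finite_cozero_cover X \<V>"
  shows "finite_cozero_cover Y ((\<lambda>V. {y \<in> topspace Y. g y \<in> V}) ` \<V>)"
  unfolding finite_cozero_cover_def
proof (intro conjI)
  show "\<Union> ((\<lambda>V. {y \<in> topspace Y. g y \<in> V}) ` \<V>) = topspace Y"
  proof (rule subset_antisym)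
    show "topspace Y \<subseteq> \<Union> ((\<lambda>V. {y \<in> topspace Y. g y \<in> V}) ` \<V>)"
    proof
      fix y assume y: "y \<in> topspace Y"
      then have "g y \<in> \<Union>\<V>"
        using assms by (auto simp: finite_cozero_cover_def continuous_map_def Pi_iff)
      with y show "y \<in> \<Union> ((\<lambda>V. {y \<in> topspace Y. g y \<in> V}) ` \<V>)" by auto
    qed
  qed auto
qed (use assms continuous_map_vimage_cozero[OF assms(1)] in \<open>auto simp: finite_cozero_cover_def\<close>)

text \<open>Covers are pulled back along both maps in turn; the order does not grow, since the
  members containing \<open>y\<close> are preimages of members containing
  \<open>g y\<close>.\<close>

lemma homeomorphic_covering_dim_le:
  assumes "homeomorphic_maps X Y f g" "covering_dim_le X n"
  shows "covering_dim_le Y n"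
  unfolding covering_dim_le_def
proof (intro allI impI)
  fix \<U> assume \<U>: "finite_cozero_cover Y \<U>"
  have f: "continuous_map X Y f" and g: "continuous_map Y X g"
    and fg: "\<And>y. y \<in> topspace Y \<Longrightarrow> f (g y) = y"
    using assms(1) by (auto simp: homeomorphic_maps_def)
  let ?pull = "\<lambda>V. {y \<in> topspace Y. g y \<in> V}"
  from assms(2) continuous_map_vimage_finite_cozero_cover[OF f \<U>]
  obtain \<V> where \<V>: "finite_cozero_cover X \<V>"
    "\<forall>V\<in>\<V>. \<exists>W\<in>(\<lambda>U. {x \<in> topspace X. f x \<in> U}) ` \<U>. V \<subseteq> W"
    "\<forall>x\<in>topspace X. card {V \<in> \<V>. x \<in> V} \<le> n + 1"
    unfolding covering_dim_le_def by blast
  have "finite_cozero_cover Y (?pull ` \<V>)"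
    by (rule continuous_map_vimage_finite_cozero_cover[OF g \<V>(1)])
  moreover have "\<forall>W\<in>?pull ` \<V>. \<exists>U\<in>\<U>. W \<subseteq> U"
  proof
    fix W assume "W \<in> ?pull ` \<V>"
    then obtain V where V: "V \<in> \<V>" "W = ?pull V" by blast
    with \<V>(2) obtain U where "U \<in> \<U>" "V \<subseteq> {x \<in> topspace X. f x \<in> U}" by blast
    then have "W \<subseteq> U" using V(2) fg by fastforce
    with \<open>U \<in> \<U>\<close> show "\<exists>U\<in>\<U>. W \<subseteq> U" by blast
  qed
  moreover have "card {W \<in> ?pull ` \<V>. y \<in> W} \<le> n + 1" if y: "y \<in> topspace Y" for y
  proof -
    have fin: "finite {V \<in> \<V>. g y \<in> V}"
      using \<V>(1) by (simp add: finite_cozero_cover_def)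
    have "{W \<in> ?pull ` \<V>. y \<in> W} \<subseteq> ?pull ` {V \<in> \<V>. g y \<in> V}"
      by auto
    then have "card {W \<in> ?pull ` \<V>. y \<in> W} \<le> card (?pull ` {V \<in> \<V>. g y \<in> V})"
      using fin by (intro card_mono) auto
    also have "\<dots> \<le> card {V \<in> \<V>. g y \<in> V}"
      using fin by (rule card_image_le)
    also have "\<dots> \<le> n + 1"
      using \<V>(3) g y by (auto simp: continuous_map_def Pi_iff)
    finally show ?thesis .
  qed
  ultimately show "\<exists>\<V>. finite_cozero_cover Y \<V> \<and> (\<forall>V\<in>\<V>. \<exists>U\<in>\<U>. V \<subseteq> U) \<and>
      (\<forall>y\<in>topspace Y. card {V \<in> \<V>. y \<in> V} \<le> n + 1)"
    by blast
qed

lemma homeomorphic_covering_dim: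
  assumes "X homeomorphic_space Y"
  shows "covering_dim X = covering_dim Y"
proof -
  obtain f g where "homeomorphic_maps X Y f g"
    using assms unfolding homeomorphic_space_def by blast
  then have "homeomorphic_maps X Y f g" "homeomorphic_maps Y X g f"
    using homeomorphic_maps_sym by blast+
  then have "covering_dim_le X n \<longleftrightarrow> covering_dim_le Y n" for n
    using homeomorphic_covering_dim_le by metis
  then show ?thesis
    unfolding covering_dim_def by simp
qed

lemma homeomorphic_tychonoff_space:
  "X homeomorphic_space Y \<Longrightarrow> tychonoff_space X \<Longrightarrow> tychonoff_space Y"
  unfolding tychonoff_space_def
  using homeomorphic_t1_space homeomorphic_completely_regular_space by blast

lemma homeomorphic_F_space:
  assumes "X homeomorphic_space Y" "F_space X"
  shows "F_space Y"
  unfolding F_space_def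
proof (intro conjI allI impI)
  show "tychonoff_space Y"
    using homeomorphic_tychonoff_space[OF assms(1)] assms(2) by (simp add: F_space_def)
  fix h assume h: "continuous_map Y euclideanreal h"
  obtain f g where f: "continuous_map X Y f" and g: "continuous_map Y X g"
    and fg: "\<And>y. y \<in> topspace Y \<Longrightarrow> f (g y) = y"
    using assms(1) by (auto simp: homeomorphic_space_def homeomorphic_maps_def)
  obtain k where k: "continuous_map X euclideanreal k"
    "\<forall>x\<in>topspace X. (h \<circ> f) x = k x * \<bar>(h \<circ> f) x\<bar>"
    using assms(2) continuous_map_compose[OF f h] unfolding F_space_def by blast
  have "h y = (k \<circ> g) y * \<bar>h y\<bar>" if "y \<in> topspace Y" for y
    using k(2)[rule_format, of "g y"] g fg[OF that] that by (auto simp: continuous_map_def Pi_iff)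
  then show "\<exists>k. continuous_map Y euclideanreal k \<and> (\<forall>y\<in>topspace Y. h y = k y * \<bar>h y\<bar>)"
    using continuous_map_compose[OF g k(1)] by blast
qed

lemma homeomorphic_zero_dimensional_space:
  "X homeomorphic_space Y \<Longrightarrow> zero_dimensional_space X \<Longrightarrow> zero_dimensional_space Y"
  unfolding zero_dimensional_space_iff
  using homeomorphic_t1_space homeomorphic_space_dimension_le by blast

lemma homeomorphic_space_inj_image:
  assumes "inj_on j (topspace X)"
  shows "X homeomorphic_space pullback_topology (j ` topspace X) (inv_into (topspace X) j) X"
    (is "_ homeomorphic_space ?Y")
proof -
  let ?i = "inv_into (topspace X) j"
  have top: "topspace ?Y = j ` topspace X"
    using assms by (auto simp: topspace_pullback_topology)
  have "continuous_map X ?Y j"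
  proof (rule continuous_map_pullback')
    have "continuous_map X X (?i \<circ> j)"
      by (rule continuous_map_eq[OF continuous_map_id]) (use assms in auto)
    then show "continuous_map X X (?i \<circ> j)" .
  qed auto
  moreover have "continuous_map ?Y X ?i"
    using continuous_map_pullback[OF continuous_map_id[of X], of "j ` topspace X" ?i] by simp
  ultimately have "homeomorphic_maps X ?Y j ?i"
    using assms unfolding homeomorphic_maps_def top by auto
  then show ?thesis
    unfolding homeomorphic_space_def by blast
qed

section \<open>Embedding the points of the example into the type \<open>point\<close>\<close>

lemma point_times_lepoll:
  assumes "(UNIV :: 'a set) \<lesssim> (UNIV :: point set)" "(UNIV :: 'b set) \<lesssim> (UNIV :: point set)"
  shows "(UNIV :: ('a \<times> 'b) set) \<lesssim> (UNIV :: point set)"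
proof -
  have inf: "infinite (UNIV :: point set)"
    by (simp add: Finite_Set.finite_set infinite_UNIV_char_0)
  have "(UNIV :: 'a set) \<times> (UNIV :: 'b set) \<lesssim> (UNIV :: point set) \<times> (UNIV :: point set)"
    using assms by (rule times_lepoll_mono)
  moreover have "(UNIV :: point set) \<times> (UNIV :: point set) \<lesssim> (UNIV :: point set)"
    using card_of_Times_same_infinite[OF inf] eqpoll_iff_card_of_ordIso eqpoll_imp_lepoll by blast
  ultimately show ?thesis
    unfolding UNIV_Times_UNIV by (rule lepoll_trans)
qed

lemma inj_lepoll: "inj (f :: 'a \<Rightarrow> 'b) \<Longrightarrow> (UNIV :: 'a set) \<lesssim> (UNIV :: 'b set)"
  unfolding lepoll_def by blast

lemma plank_lepoll_point: "(UNIV :: plank set) \<lesssim> (UNIV :: point set)"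
proof -
  \<comment> \<open>Real tags keep the three constructors apart while using only types that embed
    into \<open>point\<close>.\<close>
  let ?c = "\<lambda>t. case t of Inner \<alpha> \<gamma> \<Rightarrow> (0, \<alpha>, \<gamma>) | Side \<alpha> \<Rightarrow> (1, \<alpha>, {}) | Roof \<gamma> \<Rightarrow> (2 :: real, 0, \<gamma>)"
  have "inj ?c"
    by (auto simp: inj_def split: plank.splits)
  then have "(UNIV :: plank set) \<lesssim> (UNIV :: (real \<times> real \<times> real set) set)"
    by (rule inj_lepoll)
  also have "\<dots> \<lesssim> (UNIV :: point set)"
  proof (intro point_times_lepoll)
    have "inj (\<lambda>r :: real. {{{r}}})" "inj (\<lambda>r :: real set. {{r}})"
      by (auto simp: inj_def)
    then show "(UNIV :: real set) \<lesssim> (UNIV :: point set)" "(UNIV :: real set) \<lesssim> (UNIV :: point set)"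
      "(UNIV :: real set set) \<lesssim> (UNIV :: point set)"
      using inj_lepoll by blast+
  qed
  finally show ?thesis .
qed

text \<open>A grid element is a level with a sequence of naturals, so the graph of that sequence
  codes it as a set of reals. A filter is a set of sets of such elements, which accounts for the two
  outer layers of \<open>point\<close>.\<close>

lemma grid_filter_lepoll_point: "(UNIV :: grid filter set) \<lesssim> (UNIV :: point set)"
proof -
  define code :: "grid \<Rightarrow> real set" where
    "code x = range (\<lambda>i. real (prod_encode (i, case_nat (fst x) (snd x) i)))" for x
  have "inj code"
  proof (rule injI)
    fix x y assume eq: "code x = code y"
    have *: "case_nat (fst x) (snd x) i = case_nat (fst y) (snd y) i" for i
    proof -
      have "real (prod_encode (i, case_nat (fst x) (snd x) i)) \<in> code y"
        using eq unfolding code_def by blast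
      then show ?thesis
        unfolding code_def by auto
    qed
    show "x = y"
      using *[of 0] *[of "Suc _"] by (intro prod_eqI ext) simp_all
  qed
  have "inj (\<lambda>u :: grid filter. (image code) ` {S. eventually (\<lambda>x. x \<in> S) u})"
  proof (rule injI)
    fix u v :: "grid filter"
    assume "(image code) ` {S. eventually (\<lambda>x. x \<in> S) u} = (image code) ` {S. eventually (\<lambda>x. x \<in> S) v}"
    moreover have "inj (image code)"
      using \<open>inj code\<close> by (auto simp: inj_def inj_image_eq_iff)
    ultimately have "{S. eventually (\<lambda>x. x \<in> S) u} = {S. eventually (\<lambda>x. x \<in> S) v}"
      by (simp add: inj_image_eq_iff)
    then have "eventually (\<lambda>x. x \<in> Collect P) u = eventually (\<lambda>x. x \<in> Collect P) v" for P
      by blast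
    then show "u = v"
      by (simp add: filter_eq_iff)
  qed
  then show ?thesis
    by (rule inj_lepoll)
qed

theorem mainTheorem2:
  fixes n :: nat
  assumes "n \<ge> 1"
  shows "\<exists>X :: point topology.
           tychonoff_space X \<and> zero_dimensional_space X \<and> F_space X \<and> covering_dim X = enat n"
proof -
  obtain X :: "(plank \<times> grid filter) topology" where
    X: "tychonoff_space X" "zero_dimensional_space X" "F_space X" "covering_dim X = enat n"
    using plank_space_example[OF assms] by blast
  have "(UNIV :: (plank \<times> grid filter) set) \<lesssim> (UNIV :: point set)"
    by (rule point_times_lepoll[OF plank_lepoll_point grid_filter_lepoll_point])
  then obtain j :: "plank \<times> grid filter \<Rightarrow> point" where "inj j"
    unfolding lepoll_def by blast
  then have "inj_on j (topspace X)"
    by (rule inj_on_subset) simp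
  from homeomorphic_space_inj_image[OF this] obtain Y :: "point topology" where
    "X homeomorphic_space Y" by blast
  with X show ?thesis
    using homeomorphic_tychonoff_space homeomorphic_zero_dimensional_space homeomorphic_F_space
      homeomorphic_covering_dim by metis
qed

end
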